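(* Let $G$ be a plane graph with the ribbon structure induced by the counter-clockwise orientation of the plane. Then every Bernardi bijection on $G$ is a geometric cycle orientation map.
   Context: Graphs are finite and connected, possibly with parallel edges but without loops; cycles are simple. Bernardi bijection: for a starting pair $(v,e)$ ($v$ an endpoint of edge $e$) and spanning tree $T$, run the tour $(v_0,e_0)=(v,e)$; if $e_i\notin T$ then $v_{i+1}=v_i$ and $e_{i+1}$ is the next edge after $e_i$ in the cyclic order at $v_i$; if $e_i\in T$ then $v_{i+1}$ is the other endpoint of $e_i$ and $e_{i+1}$ the next edge after $e_i$ at $v_{i+1}$; stop once every edge has been traversed twice. $\beta_{(v,e)}(T)=\sum_{f\notin T}(\eta(f))$ where $\eta(f)$ is the vertex at the first occurrence of $f$. A cycle orientation configuration assigns an orientation to every cycle; its cycle orientation map sends $T$ to the divisor obtained by orienting each $f\notin T$ as in the oriented unique cycle of $T+f$ and placing a chip at its head. Fix reference orientations of edges, identify an oriented cycle $C$ with $\sum_{e\in C}\pm e$ in $C_1(G,\mathbb{R})$ (orthonormal basis $E(G)$; sign $+$ iff $C$ follows the reference orientation of $e$), and let $H_1(G,\mathbb{R})$ be the span of cycles. A configuration (and its map) is geometric if there is $\mathbf{w}\in H_1(G,\mathbb{R})$ with $\langle\mathbf{w},C\rangle>0$ for every configuration-oriented cycle $C$. *)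

theory Defs
  imports "HOL-Analysis.Analysis" "HOL-Combinatorics.Orbits"
begin

section \<open>Multigraphs, spanning trees and cycles\<close>

text \<open>
  The functions \<open>tail\<close> and \<open>head\<close> fix the endpoints of an edge together with its reference
  orientation; apart from chains, nothing below depends on the orientation. The edge type is finite,
  so that \<open>C\<^sub>1(G, \<real>)\<close> can be realised in \<open>real ^ 'e\<close>, but the edge set may be any subset of it.
\<close>

record ('v, 'e) multigraph =
  verts :: "'v set"
  edges :: "'e set"
  tail :: "'e \<Rightarrow> 'v"
  head :: "'e \<Rightarrow> 'v"

definition incident :: "('v, 'e) multigraph \<Rightarrow> 'v \<Rightarrow> 'e set" where
  "incident G v = {e \<in> edges G. v = tail G e \<or> v = head G e}"

definition other_end :: "('v, 'e) multigraph \<Rightarrow> 'v \<Rightarrow> 'e \<Rightarrow> 'v" where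
  "other_end G v e = (if v = tail G e then head G e else tail G e)"

definition adjacency :: "('v, 'e) multigraph \<Rightarrow> 'e set \<Rightarrow> ('v \<times> 'v) set" where
  "adjacency G F = {(x, y). \<exists>e\<in>F. {x, y} = {tail G e, head G e}}"

definition connected_by :: "('v, 'e) multigraph \<Rightarrow> 'e set \<Rightarrow> bool" where
  "connected_by G F \<longleftrightarrow>
     verts G \<noteq> {} \<and> (\<forall>x\<in>verts G. \<forall>y\<in>verts G. (x, y) \<in> (adjacency G F)\<^sup>*)"

locale connected_multigraph =
  fixes G :: "('v, 'e::finite) multigraph"
  assumes finite_verts: "finite (verts G)"
    and tail_in_verts: "e \<in> edges G \<Longrightarrow> tail G e \<in> verts G"
    and head_in_verts: "e \<in> edges G \<Longrightarrow> head G e \<in> verts G"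
    and no_loops: "e \<in> edges G \<Longrightarrow> tail G e \<noteq> head G e"
    and connected: "connected_by G (edges G)"

text \<open>
  An oriented edge is a pair \<open>(e, b)\<close>, where \<open>b\<close> says whether it follows the reference orientation.
  An oriented cycle is the set of oriented edges of a closed walk without repeated vertices or edges.
  Forbidding repeated edges excludes walking back and forth along a single edge, while two
  parallel edges do form a cycle. An unoriented cycle is identified with its set of edges.
\<close>

definition oedge_source :: "('v, 'e) multigraph \<Rightarrow> 'e \<times> bool \<Rightarrow> 'v" where
  "oedge_source G d = (if snd d then tail G (fst d) else head G (fst d))"

definition oedge_target :: "('v, 'e) multigraph \<Rightarrow> 'e \<times> bool \<Rightarrow> 'v" where
  "oedge_target G d = (if snd d then head G (fst d) else tail G (fst d))"

definition oriented_cycle :: "('v, 'e) multigraph \<Rightarrow> ('e \<times> bool) set \<Rightarrow> bool" where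
  "oriented_cycle G D \<longleftrightarrow>
     (\<exists>ds. ds \<noteq> [] \<and> set ds = D \<and> fst ` D \<subseteq> edges G \<and>
           distinct (map fst ds) \<and> distinct (map (oedge_source G) ds) \<and>
           (\<forall>i<length ds. oedge_target G (ds ! i) = oedge_source G (ds ! (Suc i mod length ds))))"

definition is_cycle :: "('v, 'e) multigraph \<Rightarrow> 'e set \<Rightarrow> bool" where
  "is_cycle G C \<longleftrightarrow> (\<exists>D. oriented_cycle G D \<and> fst ` D = C)"

definition spanning_tree :: "('v, 'e) multigraph \<Rightarrow> 'e set \<Rightarrow> bool" where
  "spanning_tree G T \<longleftrightarrow>
     T \<subseteq> edges G \<and> connected_by G T \<and> (\<forall>C. is_cycle G C \<longrightarrow> \<not> C \<subseteq> T)"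

definition fundamental_cycle :: "('v, 'e) multigraph \<Rightarrow> 'e set \<Rightarrow> 'e \<Rightarrow> 'e set" where
  "fundamental_cycle G T f = (THE C. is_cycle G C \<and> C \<subseteq> insert f T)"


section \<open>Cycle orientation maps\<close>

definition cycle_orientation_configuration ::
  "('v, 'e) multigraph \<Rightarrow> ('e set \<Rightarrow> ('e \<times> bool) set) \<Rightarrow> bool" where
  "cycle_orientation_configuration G \<sigma> \<longleftrightarrow>
     (\<forall>C. is_cycle G C \<longrightarrow> oriented_cycle G (\<sigma> C) \<and> fst ` \<sigma> C = C)"

definition head_in_cycle :: "('v, 'e) multigraph \<Rightarrow> ('e \<times> bool) set \<Rightarrow> 'e \<Rightarrow> 'v" where
  "head_in_cycle G D f = oedge_target G (THE d. d \<in> D \<and> fst d = f)"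

text \<open>Divisors are written as integer-valued functions on the vertices.\<close>

definition cycle_orientation_map ::
  "('v, 'e) multigraph \<Rightarrow> ('e set \<Rightarrow> ('e \<times> bool) set) \<Rightarrow> 'e set \<Rightarrow> 'v \<Rightarrow> int" where
  "cycle_orientation_map G \<sigma> T =
     (\<lambda>x. \<Sum>f\<in>edges G - T. of_bool (head_in_cycle G (\<sigma> (fundamental_cycle G T f)) f = x))"

definition chain :: "('e \<times> bool) set \<Rightarrow> real ^ 'e::finite" where
  "chain D = (\<Sum>(e, b)\<in>D. (if b then 1 else - 1) *\<^sub>R axis e 1)"

definition H1 :: "('v, 'e::finite) multigraph \<Rightarrow> (real ^ 'e) set" where
  "H1 G = span {chain D | D. oriented_cycle G D}"

definition geometric_configuration ::
  "('v, 'e::finite) multigraph \<Rightarrow> ('e set \<Rightarrow> ('e \<times> bool) set) \<Rightarrow> bool" where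
  "geometric_configuration G \<sigma> \<longleftrightarrow>
     (\<exists>w\<in>H1 G. \<forall>C. is_cycle G C \<longrightarrow> inner w (chain (\<sigma> C)) > 0)"

text \<open>The values of \<open>\<beta>\<close> are only relevant on spanning trees.\<close>

definition geometric_cycle_orientation_map ::
  "('v, 'e::finite) multigraph \<Rightarrow> ('e set \<Rightarrow> 'v \<Rightarrow> int) \<Rightarrow> bool" where
  "geometric_cycle_orientation_map G \<beta> \<longleftrightarrow>
     (\<exists>\<sigma>. cycle_orientation_configuration G \<sigma> \<and> geometric_configuration G \<sigma> \<and>
          (\<forall>T. spanning_tree G T \<longrightarrow> \<beta> T = cycle_orientation_map G \<sigma> T))"


section \<open>Ribbon structures and Bernardi bijections\<close>

text \<open>
  A ribbon structure is a cyclic ordering of the edges around each vertex; \<open>\<rho> v e\<close> is the edge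
  following \<open>e\<close> at \<open>v\<close>. There are no loops, so an edge occurs only once around a vertex.
\<close>

definition ribbon_structure :: "('v, 'e) multigraph \<Rightarrow> ('v \<Rightarrow> 'e \<Rightarrow> 'e) \<Rightarrow> bool" where
  "ribbon_structure G \<rho> \<longleftrightarrow>
     (\<forall>v\<in>verts G. incident G v \<noteq> {} \<longrightarrow> cyclic_on (\<rho> v) (incident G v))"

definition tour_step ::
  "('v, 'e) multigraph \<Rightarrow> ('v \<Rightarrow> 'e \<Rightarrow> 'e) \<Rightarrow> 'e set \<Rightarrow> 'v \<times> 'e \<Rightarrow> 'v \<times> 'e" where
  "tour_step G \<rho> T = (\<lambda>(v, e).
     let u = (if e \<in> T then other_end G v e else v) in (u, \<rho> u e))"

definition tour_at ::
  "('v, 'e) multigraph \<Rightarrow> ('v \<Rightarrow> 'e \<Rightarrow> 'e) \<Rightarrow> 'v \<times> 'e \<Rightarrow> 'e set \<Rightarrow> nat \<Rightarrow> 'v \<times> 'e" where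
  "tour_at G \<rho> p T i = (tour_step G \<rho> T ^^ i) p"

definition tour_length ::
  "('v, 'e) multigraph \<Rightarrow> ('v \<Rightarrow> 'e \<Rightarrow> 'e) \<Rightarrow> 'v \<times> 'e \<Rightarrow> 'e set \<Rightarrow> nat" where
  "tour_length G \<rho> p T =
     (LEAST n. \<forall>f\<in>edges G. 2 \<le> card {i. i < n \<and> snd (tour_at G \<rho> p T i) = f})"

definition tour ::
  "('v, 'e) multigraph \<Rightarrow> ('v \<Rightarrow> 'e \<Rightarrow> 'e) \<Rightarrow> 'v \<times> 'e \<Rightarrow> 'e set \<Rightarrow> ('v \<times> 'e) list" where
  "tour G \<rho> p T = map (tour_at G \<rho> p T) [0..<tour_length G \<rho> p T]"

definition first_vertex ::
  "('v, 'e) multigraph \<Rightarrow> ('v \<Rightarrow> 'e \<Rightarrow> 'e) \<Rightarrow> 'v \<times> 'e \<Rightarrow> 'e set \<Rightarrow> 'e \<Rightarrow> 'v" where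
  "first_vertex G \<rho> p T f = fst (the (find (\<lambda>q. snd q = f) (tour G \<rho> p T)))"

definition bernardi ::
  "('v, 'e) multigraph \<Rightarrow> ('v \<Rightarrow> 'e \<Rightarrow> 'e) \<Rightarrow> 'v \<times> 'e \<Rightarrow> 'e set \<Rightarrow> 'v \<Rightarrow> int" where
  "bernardi G \<rho> p T = (\<lambda>x. \<Sum>f\<in>edges G - T. of_bool (first_vertex G \<rho> p T f = x))"


section \<open>Plane graphs\<close>

text \<open>
  The vertices are points of the plane and the edge \<open>e\<close> is drawn as the (arbitrary continuous) arc
  \<open>\<gamma> e\<close> between its endpoints, parametrised along the reference orientation. The interior of an
  edge contains no vertex and no point of another edge.
\<close>

locale plane_graph = connected_multigraph G
  for G :: "(complex, 'e::finite) multigraph" +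
  fixes \<gamma> :: "'e \<Rightarrow> real \<Rightarrow> complex"
  assumes arc_edge: "e \<in> edges G \<Longrightarrow> arc (\<gamma> e)"
    and pathstart_edge: "e \<in> edges G \<Longrightarrow> pathstart (\<gamma> e) = tail G e"
    and pathfinish_edge: "e \<in> edges G \<Longrightarrow> pathfinish (\<gamma> e) = head G e"
    and edge_Int_verts: "e \<in> edges G \<Longrightarrow> path_image (\<gamma> e) \<inter> verts G = {tail G e, head G e}"
    and edge_Int_edge: "\<lbrakk>e \<in> edges G; f \<in> edges G; e \<noteq> f\<rbrakk>
          \<Longrightarrow> path_image (\<gamma> e) \<inter> path_image (\<gamma> f) \<subseteq> verts G"

definition edge_from :: "('e \<Rightarrow> real \<Rightarrow> complex) \<Rightarrow> complex \<Rightarrow> 'e \<Rightarrow> real \<Rightarrow> complex" where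
  "edge_from \<gamma> v e = (if pathstart (\<gamma> e) = v then \<gamma> e else reversepath (\<gamma> e))"

text \<open>The first point, coming from \<open>v\<close>, at which \<open>e\<close> meets the circle of radius \<open>r\<close> around \<open>v\<close>.\<close>

definition exit_point ::
  "('e \<Rightarrow> real \<Rightarrow> complex) \<Rightarrow> real \<Rightarrow> complex \<Rightarrow> 'e \<Rightarrow> complex" where
  "exit_point \<gamma> r v e =
     edge_from \<gamma> v e (Inf {t \<in> {0..1}. edge_from \<gamma> v e t \<in> sphere v r})"

definition ccw_angle ::
  "('e \<Rightarrow> real \<Rightarrow> complex) \<Rightarrow> real \<Rightarrow> complex \<Rightarrow> 'e \<Rightarrow> 'e \<Rightarrow> real" where
  "ccw_angle \<gamma> r v e f = Arg2pi ((exit_point \<gamma> r v f - v) / (exit_point \<gamma> r v e - v))"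

definition ccw_next ::
  "(complex, 'e) multigraph \<Rightarrow> ('e \<Rightarrow> real \<Rightarrow> complex) \<Rightarrow> real \<Rightarrow> complex \<Rightarrow> 'e \<Rightarrow> 'e \<Rightarrow> bool" where
  "ccw_next G \<gamma> r v e f \<longleftrightarrow>
     f \<in> incident G v \<and> (f = e \<longrightarrow> incident G v = {e}) \<and>
     (\<forall>g\<in>incident G v - {e}. ccw_angle \<gamma> r v e f \<le> ccw_angle \<gamma> r v e g)"

text \<open>
  The edges around \<open>v\<close> are ordered by the counter-clockwise order in which they first leave a small
  disc around \<open>v\<close>. For all sufficiently small radii this cyclic order is the same, and hence it is
  a property of the drawing at \<open>v\<close>; no tangent directions are needed.
\<close>

definition induced_ribbon_structure ::
  "(complex, 'e) multigraph \<Rightarrow> ('e \<Rightarrow> real \<Rightarrow> complex) \<Rightarrow> (complex \<Rightarrow> 'e \<Rightarrow> 'e) \<Rightarrow> bool" where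
  "induced_ribbon_structure G \<gamma> \<rho> \<longleftrightarrow>
     ribbon_structure G \<rho> \<and>
     (\<forall>v\<in>verts G. \<forall>e\<in>incident G v. \<forall>\<^sub>F r in at_right 0. ccw_next G \<gamma> r v e (\<rho> v e))"

end

(*
A corner of the plane graph is a pair (u, x), standing for the sector at u just before the edge x.
For an oriented cycle D, let k be 0 or 1 on a corner according to whether the corner lies to the
left or to the right of D. By the Jordan curve theorem, k changes only across the edges of D.
Reversing D if necessary, k vanishes at the starting corner of the tour.

The tour around a spanning tree T crosses only the edges outside T. For the fundamental cycle of f,
k is therefore 0 along the tour until f is first met, so f is met at its head in D.

If a convex combination of the chains of these oriented cycles were 0, then the same combination of
the functions k would be constant on all corners, hence 0 as at the starting corner, although all
its terms are nonnegative and none of them vanishes. So 0 is not in the convex hull of the chains,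
and the point of the hull closest to 0 has positive inner product with each of them.
*)

theory Submission
  imports Defs "HOL-Complex_Analysis.Winding_Numbers"
begin

section \<open>Walks, oriented cycles and their chains\<close>

text \<open>The edges are only continuous arcs, so a cycle has no tangent at a vertex, and an arc
  may re-enter a small disc after leaving it. The two sides of a cycle are therefore described
  twice. At a vertex of the cycle they are sectors of the cyclic order, bounded by the edges along
  which the cycle leaves and enters; this makes the jumps of k explicit. Away from the cycle they
  are level sets of the winding number; this makes k agree along an edge outside the cycle. The main
  work is to match the two descriptions: where an edge outside the cycle starts at a vertex of the
  cycle, its place in the cyclic order must determine the winding number along it. Locally, the
  winding numbers in the two sectors are seen to differ by 1. The Jordan curve theorem admits only
  two values, 0 and one of 1 and -1, and this leaves no choice.

  The convexity argument is Gordan's alternative: either some vector is positive on all chains, or a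
  convex combination of the chains is 0.\<close>

fun walk :: "('v, 'e) multigraph \<Rightarrow> 'v \<Rightarrow> ('e \<times> bool) list \<Rightarrow> 'v \<Rightarrow> bool" where
  "walk G u [] w \<longleftrightarrow> u = w"
| "walk G u (d # ds) w \<longleftrightarrow> oedge_source G d = u \<and> walk G (oedge_target G d) ds w"

lemma walk_append: "walk G u (xs @ ys) w \<longleftrightarrow> (\<exists>x. walk G u xs x \<and> walk G x ys w)"
  by (induction xs arbitrary: u) auto

lemma walk_iff_nth:
  "walk G u ds w \<longleftrightarrow>
     (if ds = [] then u = w
      else oedge_source G (hd ds) = u \<and> oedge_target G (last ds) = w \<and>
           (\<forall>i. Suc i < length ds \<longrightarrow> oedge_target G (ds ! i) = oedge_source G (ds ! Suc i)))"
proof (induction ds arbitrary: u)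
  case (Cons d ds)
  show ?case
  proof (cases ds)
    case (Cons d' ds')
    have all_nat: "(\<forall>i. Q i) \<longleftrightarrow> Q 0 \<and> (\<forall>i. Q (Suc i))" for Q :: "nat \<Rightarrow> bool"
      by (metis not0_implies_Suc)
    show ?thesis
      unfolding walk.simps(2) Cons.IH[of "oedge_target G d"] all_nat[of "\<lambda>i. Suc i < length (d # ds) \<longrightarrow> _ i"]
      using Cons by auto
  qed auto
qed simp

text \<open>The list form of an oriented cycle with a chosen base vertex \<open>u\<close>. Later
  arguments cut a cycle open at a given vertex, for which a set of oriented edges is too
  symmetric.\<close>

definition cycle_walk :: "('v, 'e) multigraph \<Rightarrow> 'v \<Rightarrow> ('e \<times> bool) list \<Rightarrow> bool" where
  "cycle_walk G u ds \<longleftrightarrow>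
     ds \<noteq> [] \<and> walk G u ds u \<and> fst ` set ds \<subseteq> edges G \<and>
     distinct (map fst ds) \<and> distinct (map (oedge_source G) ds)"

lemma oriented_cycle_if_cycle_walk:
  assumes "cycle_walk G u ds"
  shows "oriented_cycle G (set ds)"
proof -
  have "oedge_target G (ds ! i) = oedge_source G (ds ! (Suc i mod length ds))" if "i < length ds" for i
  proof (cases "Suc i = length ds")
    case True
    have "oedge_target G (last ds) = oedge_source G (hd ds)" "ds \<noteq> []"
      using assms by (auto simp: cycle_walk_def walk_iff_nth)
    then have "oedge_target G (ds ! (length ds - 1)) = oedge_source G (ds ! 0)"
      by (simp add: hd_conv_nth last_conv_nth)
    with True show ?thesis
      by (metis diff_Suc_1 mod_self)
  next
    case False
    with that show ?thesis
      using assms by (simp add: cycle_walk_def walk_iff_nth)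
  qed
  then show ?thesis
    using assms unfolding oriented_cycle_def cycle_walk_def by (intro exI[of _ ds]) simp
qed

lemma cycle_walk_rotate:
  assumes "cycle_walk G u (xs @ ys)" "ys \<noteq> []"
  shows "cycle_walk G (oedge_source G (hd ys)) (ys @ xs)"
proof -
  obtain x where "walk G u xs x" "walk G x ys u"
    using assms by (auto simp: cycle_walk_def walk_append)
  moreover from this assms(2) have "x = oedge_source G (hd ys)"
    by (cases ys) auto
  ultimately have "walk G (oedge_source G (hd ys)) (ys @ xs) (oedge_source G (hd ys))"
    by (auto simp: walk_append)
  then show ?thesis
    using assms by (auto simp: cycle_walk_def)
qed

lemma cycle_walk_if_oriented_cycle:
  assumes "oriented_cycle G D" "u \<in> oedge_source G ` D"
  obtains ds where "cycle_walk G u ds" "set ds = D"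
proof -
  obtain ds where ds: "ds \<noteq> []" "set ds = D" "fst ` D \<subseteq> edges G" "distinct (map fst ds)"
    "distinct (map (oedge_source G) ds)"
    "\<And>i. i < length ds \<Longrightarrow> oedge_target G (ds ! i) = oedge_source G (ds ! (Suc i mod length ds))"
    using assms unfolding oriented_cycle_def by blast
  have "walk G (oedge_source G (hd ds)) ds (oedge_source G (hd ds))"
    using ds(1) ds(6)[of "length ds - 1"] by (auto simp: walk_iff_nth hd_conv_nth last_conv_nth ds(6))
  then have cw: "cycle_walk G (oedge_source G (hd ds)) ds"
    using ds by (simp add: cycle_walk_def)
  obtain d where d: "d \<in> set ds" "u = oedge_source G d"
    using assms(2) ds(2) by auto
  then obtain xs ys where xy: "ds = xs @ d # ys"
    by (meson split_list)
  have "cycle_walk G u ((d # ys) @ xs)"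
    using cycle_walk_rotate[of G _ xs "d # ys"] cw xy d by simp
  then show ?thesis
    using that[of "(d # ys) @ xs"] ds(2) xy by auto
qed

lemma walk_sources_targets:
  "walk G u ds w \<Longrightarrow> insert w (oedge_source G ` set ds) = insert u (oedge_target G ` set ds)"
  by (induction ds arbitrary: u) auto

lemma cycle_walk_sources_eq_targets:
  assumes "cycle_walk G u ds"
  shows "oedge_source G ` set ds = oedge_target G ` set ds"
proof -
  have "oedge_source G (hd ds) = u" "oedge_target G (last ds) = u" "ds \<noteq> []"
    using assms by (auto simp: cycle_walk_def walk_iff_nth)
  then have "u \<in> oedge_source G ` set ds" "u \<in> oedge_target G ` set ds"
    by (metis hd_in_set last_in_set imageI)+
  then show ?thesis
    using walk_sources_targets[of G u ds u] assms by (auto simp: cycle_walk_def insert_absorb)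
qed

lemma oriented_cycle_nonempty: "oriented_cycle G D \<Longrightarrow> D \<noteq> {}"
  by (auto simp: oriented_cycle_def)

lemma oriented_cycle_edges: "oriented_cycle G D \<Longrightarrow> fst ` D \<subseteq> edges G"
  by (auto simp: oriented_cycle_def)

lemma oriented_cycle_inj_fst: "oriented_cycle G D \<Longrightarrow> inj_on fst D"
  by (auto simp: oriented_cycle_def distinct_map)

lemma oriented_cycle_inj_source: "oriented_cycle G D \<Longrightarrow> inj_on (oedge_source G) D"
  by (auto simp: oriented_cycle_def distinct_map)

lemma oriented_cycle_sources_eq_targets:
  assumes "oriented_cycle G D"
  shows "oedge_source G ` D = oedge_target G ` D"
proof -
  obtain d where "d \<in> D"
    using oriented_cycle_nonempty[OF assms] by blast
  then obtain ds where "cycle_walk G (oedge_source G d) ds" "set ds = D"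
    using cycle_walk_if_oriented_cycle[OF assms] by blast
  then show ?thesis
    using cycle_walk_sources_eq_targets[of G _ ds] by simp
qed

text \<open>Sources and targets form the same set, which has as many elements as \<open>D\<close>.
  Hence each vertex of the cycle has a unique incoming edge as well as a unique outgoing
  one.\<close>

lemma oriented_cycle_inj_target:
  assumes "oriented_cycle G D"
  shows "inj_on (oedge_target G) D"
proof -
  have "finite D"
    using assms by (auto simp: oriented_cycle_def)
  moreover have "card (oedge_target G ` D) = card D"
    using oriented_cycle_sources_eq_targets[OF assms] card_image[OF oriented_cycle_inj_source[OF assms]]
    by simp
  ultimately show ?thesis
    by (simp add: eq_card_imp_inj_on)
qed

section \<open>Chains of cycles and their orthogonality to cuts\<close>

abbreviation (input) orientation_sign :: "'e \<times> bool \<Rightarrow> real" where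
  "orientation_sign d \<equiv> (if snd d then 1 else - 1)"

lemma chain_alt: "chain D = (\<Sum>d\<in>D. orientation_sign d *\<^sub>R axis (fst d) 1)"
  by (simp add: chain_def case_prod_beta)

lemma chain_nth: "chain D $ e = of_bool ((e, True) \<in> D) - of_bool ((e, False) \<in> D)"
proof -
  have "chain D $ e = (\<Sum>d\<in>D. if fst d = e then orientation_sign d else 0)"
    unfolding chain_alt by (auto simp: axis_def if_distrib intro!: sum.cong)
  also have "\<dots> = (\<Sum>d\<in>D \<inter> {d. fst d = e}. orientation_sign d)"
    by (simp add: sum.inter_restrict)
  also have "D \<inter> {d. fst d = e} = D \<inter> {(e, True), (e, False)}"
    by (auto intro: prod_eqI)
  also have "(\<Sum>d\<in>\<dots>. orientation_sign d) = of_bool ((e, True) \<in> D) - of_bool ((e, False) \<in> D)"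
    by (cases "(e, True) \<in> D"; cases "(e, False) \<in> D") (auto simp: Int_insert_right)
  finally show ?thesis .
qed

lemma inner_chain: "inner (chain D) x = (\<Sum>d\<in>D. orientation_sign d * (x $ fst d))"
  unfolding chain_alt inner_sum_left by (auto simp: inner_axis' intro!: sum.cong)

lemma oriented_cycle_chain_nth:
  assumes "oriented_cycle G D" "(e, b) \<in> D"
  shows "chain D $ e = orientation_sign (e, b)"
proof -
  have "(e, \<not> b) \<notin> D"
    using inj_onD[OF oriented_cycle_inj_fst[OF assms(1)], of "(e, b)" "(e, \<not> b)"] assms(2) by auto
  with assms(2) show ?thesis
    by (cases b) (auto simp: chain_nth)
qed

lemma oriented_cycle_chain_nth_eq_0_iff:
  assumes "oriented_cycle G D"
  shows "chain D $ e = 0 \<longleftrightarrow> e \<notin> fst ` D"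
proof (cases "e \<in> fst ` D")
  case True
  then obtain b where "(e, b) \<in> D" by force
  then show ?thesis
    using oriented_cycle_chain_nth[OF assms] True by auto
next
  case False
  then have "(e, b) \<notin> D" for b by force
  with False show ?thesis by (auto simp: chain_nth)
qed

lemma walk_sum_cut:
  "walk G u ds w \<Longrightarrow>
    (\<Sum>d\<leftarrow>ds. of_bool (oedge_target G d \<in> A) - of_bool (oedge_source G d \<in> A)) =
    (of_bool (w \<in> A) - of_bool (u \<in> A) :: real)"
  by (induction ds arbitrary: u) auto

text \<open>A closed walk enters \<open>A\<close> as often as it leaves \<open>A\<close>; the sum
  telescopes.\<close>

lemma inner_chain_cut_eq_0:
  assumes "oriented_cycle G D"
  shows "inner (chain D) (\<chi> e. of_bool (head G e \<in> A) - of_bool (tail G e \<in> A)) = 0"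
proof -
  obtain d where "d \<in> D"
    using oriented_cycle_nonempty[OF assms] by blast
  then obtain ds where ds: "cycle_walk G (oedge_source G d) ds" "set ds = D"
    using cycle_walk_if_oriented_cycle[OF assms] by blast
  then have "distinct ds"
    by (auto simp: cycle_walk_def distinct_map)
  have "inner (chain D) (\<chi> e. of_bool (head G e \<in> A) - of_bool (tail G e \<in> A)) =
      (\<Sum>d\<in>set ds. of_bool (oedge_target G d \<in> A) - of_bool (oedge_source G d \<in> A))"
    unfolding inner_chain ds(2) by (auto simp: oedge_source_def oedge_target_def intro!: sum.cong)
  also have "\<dots> = (\<Sum>d\<leftarrow>ds. of_bool (oedge_target G d \<in> A) - of_bool (oedge_source G d \<in> A))"
    using \<open>distinct ds\<close> by (simp add: sum_list_distinct_conv_sum_set)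
  also have "\<dots> = 0"
    using ds by (simp add: cycle_walk_def walk_sum_cut[where u = "oedge_source G d" and w = "oedge_source G d"])
  finally show ?thesis .
qed

section \<open>Simple walks and cycles from reachability\<close>

lemma obtain_orientation:
  assumes "{x, y} = {tail G e, head G e}"
  obtains b where "oedge_source G (e, b) = x" "oedge_target G (e, b) = y"
  using assms that[of True] that[of False]
  by (auto simp: oedge_source_def oedge_target_def doubleton_eq_iff)

text \<open>Loop erasure. The walk grows at its front; if the new vertex already occurs, everything
  before that occurrence is dropped. Otherwise the new vertex is an end of no edge used so far, so
  the new edge is not a repetition either.\<close>

lemma simple_walk_if_rtrancl:
  assumes "(u, w) \<in> (adjacency G F)\<^sup>*"
  shows "\<exists>ds. walk G u ds w \<and> fst ` set ds \<subseteq> F \<and> distinct (map fst ds) \<and>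
           distinct (map (oedge_source G) ds) \<and> w \<notin> oedge_source G ` set ds"
  using assms
proof (induction rule: converse_rtrancl_induct)
  case base
  show ?case by (intro exI[of _ "[]"]) simp
next
  case (step x y)
  from step.IH obtain ds where ds: "walk G y ds w" "fst ` set ds \<subseteq> F" "distinct (map fst ds)"
      "distinct (map (oedge_source G) ds)" "w \<notin> oedge_source G ` set ds"
    by blast
  show ?case
  proof (cases "x \<in> insert w (oedge_source G ` set ds)")
    case True
    show ?thesis
    proof (cases "x = w")
      case True
      then show ?thesis by (intro exI[of _ "[]"]) simp
    next
      case False
      then obtain d where d: "d \<in> set ds" "x = oedge_source G d"
        using True by blast
      then obtain xs ys where xy: "ds = xs @ d # ys"
        by (meson split_list)
      then show ?thesis
        using ds d by (intro exI[of _ "d # ys"]) (auto simp: walk_append)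
    qed
  next
    case False
    obtain e where e: "e \<in> F" "{x, y} = {tail G e, head G e}"
      using step.hyps(1) by (auto simp: adjacency_def)
    obtain b where b: "oedge_source G (e, b) = x" "oedge_target G (e, b) = y"
      using obtain_orientation[OF e(2)] .
    have sub: "oedge_source G ` set ds \<union> oedge_target G ` set ds \<subseteq> insert y (insert w (oedge_source G ` set ds))"
      using walk_sources_targets[OF ds(1)] by blast
    have "y \<in> insert w (oedge_source G ` set ds)"
      using walk_sources_targets[OF ds(1)] by blast
    then have "x \<notin> oedge_source G ` set ds \<union> oedge_target G ` set ds"
      using False sub by blast
    moreover have "x \<in> {tail G e, head G e}"
      using e by blast
    ultimately have "e \<notin> fst ` set ds"
      by (auto simp: oedge_source_def oedge_target_def image_iff split: if_splits)
    then show ?thesis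
      using ds b e False by (intro exI[of _ "(e, b) # ds"]) auto
  qed
qed

lemma cycle_through_if_rtrancl:
  assumes "(u, w) \<in> (adjacency G F)\<^sup>*" "{u, w} = {tail G e, head G e}" "e \<notin> F"
    and "insert e F \<subseteq> edges G"
  obtains D where "oriented_cycle G D" "fst ` D \<subseteq> insert e F" "e \<in> fst ` D"
proof -
  obtain ds where ds: "walk G u ds w" "fst ` set ds \<subseteq> F" "distinct (map fst ds)"
      "distinct (map (oedge_source G) ds)" "w \<notin> oedge_source G ` set ds"
    using simple_walk_if_rtrancl[OF assms(1)] by blast
  have "{w, u} = {tail G e, head G e}"
    using assms(2) by (simp add: insert_commute)
  then obtain b where b: "oedge_source G (e, b) = w" "oedge_target G (e, b) = u"
    by (rule obtain_orientation)
  have "cycle_walk G u (ds @ [(e, b)])"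
    using ds b assms by (auto simp: cycle_walk_def walk_append)
  from oriented_cycle_if_cycle_walk[OF this] show ?thesis
    by (rule that) (use ds in auto)
qed


section \<open>Fundamental cycles\<close>

context connected_multigraph
begin

definition darts :: "('v \<times> 'e) set" where
  "darts = {(v, e). v \<in> verts G \<and> e \<in> incident G v}"

lemma darts_iff: "(v, e) \<in> darts \<longleftrightarrow> e \<in> edges G \<and> (v = tail G e \<or> v = head G e)"
  using tail_in_verts head_in_verts by (auto simp: darts_def incident_def)

lemma other_end_eq:
  assumes "e \<in> edges G"
  shows "other_end G (tail G e) e = head G e" "other_end G (head G e) e = tail G e"
  using no_loops[OF assms] by (auto simp: other_end_def)

lemma finite_darts: "finite darts"
proof -
  have "darts \<subseteq> verts G \<times> UNIV"
    by (auto simp: darts_def)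
  then show ?thesis
    using finite_verts finite_subset by fastforce
qed

lemma tree_edge_cut:
  assumes "spanning_tree G T" "e \<in> T" "{u, w} = {tail G e, head G e}"
  shows "(u, w) \<notin> (adjacency G (T - {e}))\<^sup>*"
proof
  assume "(u, w) \<in> (adjacency G (T - {e}))\<^sup>*"
  then obtain D where "oriented_cycle G D" "fst ` D \<subseteq> insert e (T - {e})"
    using assms by (elim cycle_through_if_rtrancl) (auto simp: spanning_tree_def)
  then show False
    using assms unfolding spanning_tree_def is_cycle_def by blast
qed

text \<open>\<open>A\<close> is the component of \<open>u\<close> in \<open>T - {e}\<close>, so
  \<open>e\<close> is the only edge of \<open>T\<close> that can leave it.\<close>

lemma reachable_cut:
  fixes T :: "'e set" and e :: 'e and u :: 'v
  defines "A \<equiv> {x. (u, x) \<in> (adjacency G (T - {e}))\<^sup>*}"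
  assumes "x \<in> T" "x \<noteq> e"
  shows "tail G x \<in> A \<longleftrightarrow> head G x \<in> A"
proof -
  have "(tail G x, head G x) \<in> adjacency G (T - {e})" "(head G x, tail G x) \<in> adjacency G (T - {e})"
    using assms by (auto simp: adjacency_def)
  then show ?thesis
    unfolding A_def by (auto intro: rtrancl_into_rtrancl)
qed

text \<open>Uniqueness by linear algebra: the coefficient of a tree edge \<open>e\<close> in a cycle
  within \<open>insert f T\<close> is a fixed multiple of the coefficient of \<open>f\<close>, and
  the latter is never 0, as \<open>T\<close> contains no cycle. So either all such cycles use
  \<open>e\<close> or none does.\<close>

lemma fundamental_cycle_unique:
  assumes T: "spanning_tree G T" and f: "f \<in> edges G - T"
    and D: "oriented_cycle G D" "fst ` D \<subseteq> insert f T"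
    and D': "oriented_cycle G D'" "fst ` D' \<subseteq> insert f T"
  shows "fst ` D \<subseteq> fst ` D'"
proof
  fix e assume e: "e \<in> fst ` D"
  have f_in: "f \<in> fst ` D''" if "oriented_cycle G D''" "fst ` D'' \<subseteq> insert f T" for D''
    using T that unfolding spanning_tree_def is_cycle_def by blast
  show "e \<in> fst ` D'"
  proof (cases "e = f")
    case True
    then show ?thesis using f_in[OF D'] by simp
  next
    case False
    then have "e \<in> T" using e D by blast
    define A where "A = {x. (tail G e, x) \<in> (adjacency G (T - {e}))\<^sup>*}"
    define c :: "'e \<Rightarrow> real" where "c x = of_bool (head G x \<in> A) - of_bool (tail G x \<in> A)" for x
    have ce: "c e = - 1"
      using tree_edge_cut[OF T \<open>e \<in> T\<close>, of "tail G e" "head G e"] by (simp add: c_def A_def)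
    have cx: "c x = 0" if "x \<in> T" "x \<noteq> e" for x
      using reachable_cut[OF that, of "tail G e"] by (simp add: c_def A_def)
    \<comment> \<open>Orthogonality to the cut of \<open>A\<close>: within
      \<open>insert f T\<close>, only \<open>e\<close> and \<open>f\<close> can cross it, and
      \<open>e\<close> does so with sign -1.\<close>
    have eq: "chain D'' $ e = c f * chain D'' $ f"
      if "oriented_cycle G D''" "fst ` D'' \<subseteq> insert f T" for D''
    proof -
      have zero: "chain D'' $ x * c x = 0" if "x \<notin> {e, f}" for x
        using that cx oriented_cycle_chain_nth_eq_0_iff[OF \<open>oriented_cycle G D''\<close>, of x]
          \<open>fst ` D'' \<subseteq> insert f T\<close>
        by (cases "x \<in> T") auto
      have "0 = inner (chain D'') (\<chi> x. c x)"
        using inner_chain_cut_eq_0[OF that(1), of A] by (simp add: c_def)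
      also have "\<dots> = (\<Sum>x\<in>UNIV. chain D'' $ x * c x)"
        by (simp add: inner_vec_def)
      also have "\<dots> = (\<Sum>x\<in>{e, f}. chain D'' $ x * c x)"
        using zero by (intro sum.mono_neutral_right) auto
      also have "\<dots> = c f * chain D'' $ f - chain D'' $ e"
        using False ce by simp
      finally show ?thesis by simp
    qed
    have "chain D $ e \<noteq> 0" "chain D' $ f \<noteq> 0"
      using e f_in[OF D'] oriented_cycle_chain_nth_eq_0_iff D D' by metis+
    then have "chain D' $ e \<noteq> 0"
      using eq[OF D] eq[OF D'] by auto
    then show ?thesis
      using oriented_cycle_chain_nth_eq_0_iff[OF D'(1)] by blast
  qed
qed

lemma fundamental_cycle:
  assumes T: "spanning_tree G T" and f: "f \<in> edges G - T"
  shows "is_cycle G (fundamental_cycle G T f)" "fundamental_cycle G T f \<subseteq> insert f T"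
    "f \<in> fundamental_cycle G T f"
proof -
  have "(tail G f, head G f) \<in> (adjacency G T)\<^sup>*"
    using T f tail_in_verts head_in_verts unfolding spanning_tree_def connected_by_def by blast
  then obtain D where D: "oriented_cycle G D" "fst ` D \<subseteq> insert f T"
    using T f by (elim cycle_through_if_rtrancl) (auto simp: spanning_tree_def)
  have "\<exists>!C. is_cycle G C \<and> C \<subseteq> insert f T"
  proof (rule ex1I[of _ "fst ` D"])
    show "is_cycle G (fst ` D) \<and> fst ` D \<subseteq> insert f T"
      using D by (auto simp: is_cycle_def)
    fix C assume "is_cycle G C \<and> C \<subseteq> insert f T"
    then obtain D' where "oriented_cycle G D'" "fst ` D' = C" "fst ` D' \<subseteq> insert f T"
      by (auto simp: is_cycle_def)
    then show "C = fst ` D"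
      using fundamental_cycle_unique[OF T f] D by blast
  qed
  then have *: "is_cycle G (fundamental_cycle G T f) \<and> fundamental_cycle G T f \<subseteq> insert f T"
    unfolding fundamental_cycle_def by (rule theI')
  then show "is_cycle G (fundamental_cycle G T f)" "fundamental_cycle G T f \<subseteq> insert f T"
    by blast+
  then show "f \<in> fundamental_cycle G T f"
    using T unfolding spanning_tree_def by blast
qed

end

section \<open>Ribbon structures and potentials on corners\<close>

locale ribbon_graph = connected_multigraph G
  for G :: "('v, 'e::finite) multigraph" +
  fixes \<rho> :: "'v \<Rightarrow> 'e \<Rightarrow> 'e"
  assumes ribbon: "ribbon_structure G \<rho>"
begin

lemma cyclic_on_incident: "(v, e) \<in> darts \<Longrightarrow> cyclic_on (\<rho> v) (incident G v)"
  using ribbon by (auto simp: ribbon_structure_def darts_def)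

lemma rho_in_darts: "(v, e) \<in> darts \<Longrightarrow> (v, \<rho> v e) \<in> darts"
  using cyclic_on_incident[of v e] cyclic_on_inI[of "\<rho> v" "incident G v" e] by (auto simp: darts_def)

text \<open>Each edge lies in its own orbit, so the rotation is onto a finite set and therefore
  injective.\<close>

lemma inj_on_rho:
  assumes "(v, e) \<in> darts"
  shows "inj_on (\<rho> v) (incident G v)"
proof -
  have "x \<in> \<rho> v ` incident G v" if "x \<in> incident G v" for x
  proof -
    have "x \<in> orbit (\<rho> v) x" and sub: "orbit (\<rho> v) x = incident G v"
      using cyclic_on_incident[OF assms] that by (auto simp: cyclic_on_alldef)
    then show ?thesis
      using that by (cases rule: orbit.cases) auto
  qed
  then have "\<rho> v ` incident G v = incident G v"
    using cyclic_on_incident[OF assms] by (auto intro: cyclic_on_inI)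
  then show ?thesis
    by (simp add: eq_card_imp_inj_on)
qed

text \<open>Induction over all corners by turning around vertices and moving along the edges of a
  connecting set \<open>F\<close>. It is used with all edges for \<open>F\<close>, and with a
  spanning tree. Moving along an edge may end at any corner \<open>y\<close> of the other vertex,
  since turning reaches the others from there.\<close>

lemma darts_induct:
  assumes start: "(v, e) \<in> darts" "P v e"
    and next_edge: "\<And>u x. (u, x) \<in> darts \<Longrightarrow> P u x \<Longrightarrow> P u (\<rho> u x)"
    and cross: "\<And>u x. (u, x) \<in> darts \<Longrightarrow> x \<in> F \<Longrightarrow> P u x \<Longrightarrow> \<exists>y. (other_end G u x, y) \<in> darts \<and> P (other_end G u x) y"
    and conn: "connected_by G F" "F \<subseteq> edges G"
    and "(w, y) \<in> darts"
  shows "P w y"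
proof -
  have around: "P u x'" if "(u, x) \<in> darts" "P u x" "(u, x') \<in> darts" for u x x'
  proof -
    have "x' \<in> orbit (\<rho> u) x"
      using cyclic_on_incident[OF that(1)] that by (auto simp: cyclic_on_alldef darts_def)
    then show ?thesis
    proof (induction rule: orbit.induct)
      case base
      then show ?case using that next_edge by blast
    next
      case (step z)
      have "z \<in> incident G u"
        using step.hyps cyclic_on_incident[OF that(1)] that by (auto simp: cyclic_on_alldef darts_def)
      then show ?case using step that next_edge by (auto simp: darts_def)
    qed
  qed
  have "(v, w) \<in> (adjacency G F)\<^sup>*"
    using conn start(1) assms(7) by (auto simp: connected_by_def darts_def)
  then have "\<exists>x. (w, x) \<in> darts \<and> P w x"
  proof (induction rule: rtrancl_induct)
    case base
    then show ?case using start by blast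
  next
    case (step u u')
    then obtain x where x: "x \<in> F" "{u, u'} = {tail G x, head G x}"
      by (auto simp: adjacency_def)
    then have d: "(u, x) \<in> darts" "other_end G u x = u'"
      using conn other_end_eq by (auto simp: darts_iff doubleton_eq_iff)
    then have "P u x"
      using step.IH around by blast
    then show ?case
      using cross[OF d(1) x(1)] d by auto
  qed
  then show ?thesis
    using around assms(7) by blast
qed

text \<open>
  The value \<open>k u x\<close> is attached to the corner at \<open>u\<close> just before \<open>x\<close>. The second condition compares
  the two ends of one side of \<open>x\<close>, so \<open>k\<close> is a function on the faces and \<open>z\<close> is its coboundary.
\<close>

definition dual_potential :: "real ^ 'e \<Rightarrow> ('v \<Rightarrow> 'e \<Rightarrow> real) \<Rightarrow> bool" where
  "dual_potential z k \<longleftrightarrow>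
     (\<forall>(u, x)\<in>darts. k u (\<rho> u x) = k u x + (if u = head G x then z $ x else - (z $ x)) \<and>
        k u x = k (other_end G u x) (\<rho> (other_end G u x) x))"

lemma dual_potential_rho:
  "dual_potential z k \<Longrightarrow> (u, x) \<in> darts \<Longrightarrow>
     k u (\<rho> u x) = k u x + (if u = head G x then z $ x else - (z $ x))"
  and dual_potential_other_end:
  "dual_potential z k \<Longrightarrow> (u, x) \<in> darts \<Longrightarrow> k (other_end G u x) (\<rho> (other_end G u x) x) = k u x"
  by (auto simp: dual_potential_def)

lemma dual_potential_sum:
  assumes "\<And>i. i \<in> I \<Longrightarrow> dual_potential (z i) (k i)"
  shows "dual_potential (\<Sum>i\<in>I. c i *\<^sub>R z i) (\<lambda>u x. \<Sum>i\<in>I. c i * k i u x)"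
proof -
  have "(\<Sum>i\<in>I. c i * k i u (\<rho> u x)) =
      (\<Sum>i\<in>I. c i * k i u x + c i * (if u = head G x then z i $ x else - (z i $ x)))"
    "(\<Sum>i\<in>I. c i * k i (other_end G u x) (\<rho> (other_end G u x) x)) = (\<Sum>i\<in>I. c i * k i u x)"
    if "(u, x) \<in> darts" for u x
    using that
    by (auto simp: dual_potential_rho[OF assms] dual_potential_other_end[OF assms] algebra_simps
        intro!: sum.cong)
  then show ?thesis
    unfolding dual_potential_def by (auto simp: sum.distrib sum_negf)
qed

text \<open>Without jumps, both turning at a vertex and following the side of an edge preserve
  \<open>k\<close>, and these moves connect all corners.\<close>

lemma dual_potential_0_constant:
  assumes k: "dual_potential 0 k" and "(v, e) \<in> darts" "(w, x) \<in> darts"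
  shows "k w x = k v e"
proof (rule darts_induct[where P = "\<lambda>w x. k w x = k v e", OF assms(2) refl _ _ connected _ assms(3)])
  fix u x assume ux: "(u, x) \<in> darts" "k u x = k v e"
  then show "k u (\<rho> u x) = k v e"
    using dual_potential_rho[OF k] by simp
  have d: "(other_end G u x, x) \<in> darts"
    using ux by (auto simp: darts_iff other_end_def)
  then show "\<exists>y. (other_end G u x, y) \<in> darts \<and> k (other_end G u x) y = k v e"
    using dual_potential_other_end[OF k ux(1)] rho_in_darts[OF d] ux(2)
    by (intro exI[of _ "\<rho> (other_end G u x) x"]) auto
qed simp

end


section \<open>The Bernardi tour\<close>

context ribbon_graph
begin

lemma other_end_in_darts: "(u, x) \<in> darts \<Longrightarrow> (other_end G u x, x) \<in> darts"
  by (auto simp: darts_iff other_end_def)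

lemma other_end_other_end: "(u, x) \<in> darts \<Longrightarrow> other_end G (other_end G u x) x = u"
  by (auto simp: darts_iff other_end_def)

lemma tour_step_eq:
  "tour_step G \<rho> T (u, x) =
    (if x \<in> T then (other_end G u x, \<rho> (other_end G u x) x) else (u, \<rho> u x))"
  by (simp add: tour_step_def Let_def)

lemma tour_step_in_darts: "d \<in> darts \<Longrightarrow> tour_step G \<rho> T d \<in> darts"
  by (cases d) (auto simp: tour_step_eq rho_in_darts other_end_in_darts)

lemma inj_on_tour_step: "inj_on (tour_step G \<rho> T) darts"
proof (rule inj_onI)
  fix d d' assume d: "d \<in> darts" "d' \<in> darts" "tour_step G \<rho> T d = tour_step G \<rho> T d'"
  \<comment> \<open>A step of the tour is an involution of the darts, swapping the ends of tree
    edges, followed by the rotation at the vertex reached; both are injective.\<close>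
  define turn where "turn = (\<lambda>(u, x). (if x \<in> T then other_end G u x else u, x))"
  have turn: "turn d'' \<in> darts" "turn (turn d'') = d''" if "d'' \<in> darts" for d''
    using that by (cases d''; auto simp: turn_def other_end_in_darts other_end_other_end)+
  have step: "tour_step G \<rho> T d'' = (fst (turn d''), \<rho> (fst (turn d'')) (snd (turn d'')))" for d''
    by (cases d'') (simp add: turn_def tour_step_eq)
  obtain u x y where *: "turn d = (u, x)" "turn d' = (u, y)" "\<rho> u x = \<rho> u y"
    using d(3) unfolding step by (cases "turn d"; cases "turn d'") auto
  then have "(u, x) \<in> darts" "(u, y) \<in> darts"
    using turn(1)[OF d(1)] turn(1)[OF d(2)] by simp_all
  then have "x = y"
    using inj_onD[OF inj_on_rho *(3)] by (auto simp: darts_def)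
  then show "d = d'"
    using turn(2)[OF d(1)] turn(2)[OF d(2)] * by simp
qed

lemma tour_at_Suc: "tour_at G \<rho> p T (Suc i) = tour_step G \<rho> T (tour_at G \<rho> p T i)"
  by (simp add: tour_at_def)

lemma tour_at_in_darts: "p \<in> darts \<Longrightarrow> tour_at G \<rho> p T i \<in> darts"
  by (induction i) (simp_all add: tour_at_Suc tour_step_in_darts, simp add: tour_at_def)

text \<open>
  The tour is a cyclic orbit, so it crosses the cut of \<open>T - x\<close> as often in one direction as in the
  other, and \<open>x\<close> is the only edge of \<open>T\<close> in this cut.
\<close>

lemma tour_range_other_end:
  assumes T: "spanning_tree G T" and p: "p \<in> darts" and x: "x \<in> T"
    and ux: "(u, x) \<in> range (tour_at G \<rho> p T)"
  shows "(other_end G u x, x) \<in> range (tour_at G \<rho> p T)"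
proof (rule ccontr)
  define S where "S = range (tour_at G \<rho> p T)"
  define A where "A = {y. (u, y) \<in> (adjacency G (T - {x}))\<^sup>*}"
  assume contra: "(other_end G u x, x) \<notin> range (tour_at G \<rho> p T)"
  let ?step = "tour_step G \<rho> T"
  have S: "S \<subseteq> darts" "?step ` S \<subseteq> S"
    using tour_at_in_darts[OF p] by (auto simp: S_def simp flip: tour_at_Suc)
  have fin: "finite S"
    using S finite_darts finite_subset by blast
  have inj: "inj_on ?step S"
    using inj_on_tour_step S inj_on_subset by blast
  have surj: "?step ` S = S"
    using endo_inj_surj[OF fin S(2) inj] .
  have ux_darts: "(u, x) \<in> darts"
    using ux S by (auto simp: S_def)
  have "{u, other_end G u x} = {tail G x, head G x}"
    using ux_darts other_end_eq by (auto simp: darts_iff)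
  then have cut: "other_end G u x \<notin> A" "u \<in> A"
    using tree_edge_cut[OF T x] by (auto simp: A_def)
  \<comment> \<open>The step permutes \<open>S\<close>, so \<open>P\<close> has as many elements as
    the set of darts of \<open>S\<close> based in \<open>A\<close>. Without the reverse crossing of
    \<open>x\<close>, no dart of \<open>S\<close> enters \<open>A\<close> while
    \<open>(u, x)\<close> leaves it, so \<open>P\<close> would be a proper subset of that
    set.\<close>
  define P where "P = {d \<in> S. fst (?step d) \<in> A}"
  have "fst d \<in> A" if d: "d \<in> P" for d
  proof -
    obtain w y where wy: "d = (w, y)" by (cases d)
    have wy_darts: "(w, y) \<in> darts" using d wy S by (auto simp: P_def)
    show ?thesis
    proof (cases "y \<in> T")
      case True
      have "other_end G w y \<in> A"
        using d True wy by (simp add: P_def tour_step_eq)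
      moreover have "w \<in> A \<longleftrightarrow> other_end G w y \<in> A" if "y \<noteq> x"
        using reachable_cut[OF True that, of u] wy_darts other_end_eq by (auto simp: A_def darts_iff)
      moreover have "w = u" if "y = x"
      proof -
        have "w \<noteq> other_end G u x"
          using contra d wy that by (auto simp: P_def S_def)
        then show ?thesis
          using wy_darts ux_darts that other_end_eq by (auto simp: darts_iff)
      qed
      ultimately show ?thesis using cut wy by auto
    next
      case False
      then show ?thesis using d wy by (simp add: P_def tour_step_eq)
    qed
  qed
  moreover have "(u, x) \<notin> P"
    using cut x by (simp add: P_def tour_step_eq)
  moreover have "(u, x) \<in> {d \<in> S. fst d \<in> A}"
    using ux cut by (simp add: S_def)
  moreover have "P \<subseteq> S"
    by (simp add: P_def)
  ultimately have "P \<subset> {d \<in> S. fst d \<in> A}"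
    by blast
  then have "card P < card {d \<in> S. fst d \<in> A}"
    using fin by (intro psubset_card_mono) auto
  moreover have "?step ` P = ?step ` S \<inter> {d. fst d \<in> A}"
    by (auto simp: P_def)
  then have "?step ` P = {d \<in> S. fst d \<in> A}"
    unfolding surj by blast
  moreover have "card (?step ` P) = card P"
    using inj by (intro card_image) (auto simp: P_def intro: inj_on_subset)
  ultimately show False by simp
qed

text \<open>The visited darts are closed under the rotation: for \<open>x\<close> outside
  \<open>T\<close> the tour itself turns at \<open>u\<close>, and for \<open>x\<close> in
  \<open>T\<close> the dart at the other end of \<open>x\<close> is visited too, and the step from
  there leads to \<open>(u, \<rho> u x)\<close>.\<close>

lemma tour_range:
  assumes T: "spanning_tree G T" and p: "p \<in> darts"
  shows "range (tour_at G \<rho> p T) = darts"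
proof
  show "range (tour_at G \<rho> p T) \<subseteq> darts"
    using tour_at_in_darts[OF p] by blast
  have step: "tour_step G \<rho> T d \<in> range (tour_at G \<rho> p T)" if "d \<in> range (tour_at G \<rho> p T)" for d
    using that by (auto simp flip: tour_at_Suc)
  have p_in: "p \<in> range (tour_at G \<rho> p T)"
    by (rule range_eqI[of _ _ 0]) (simp add: tour_at_def)
  show "darts \<subseteq> range (tour_at G \<rho> p T)"
  proof clarify
    fix w y assume wy: "(w, y) \<in> darts"
    show "(w, y) \<in> range (tour_at G \<rho> p T)"
    proof (rule darts_induct[where P = "\<lambda>w y. (w, y) \<in> range (tour_at G \<rho> p T)" and F = T
          and v = "fst p" and e = "snd p", OF _ _ _ _ _ _ wy])
      fix u x assume ux: "(u, x) \<in> darts" "(u, x) \<in> range (tour_at G \<rho> p T)"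
      show "(u, \<rho> u x) \<in> range (tour_at G \<rho> p T)"
      proof (cases "x \<in> T")
        case True
        show ?thesis
          using step[OF tour_range_other_end[OF T p True ux(2)]] True other_end_other_end[OF ux(1)]
          by (simp add: tour_step_eq)
      next
        case False
        then show ?thesis using step[OF ux(2)] by (simp add: tour_step_eq)
      qed
      show "\<exists>y. (other_end G u x, y) \<in> darts \<and> (other_end G u x, y) \<in> range (tour_at G \<rho> p T)"
        if "x \<in> T"
        using tour_range_other_end[OF T p that ux(2)] other_end_in_darts[OF ux(1)] by blast
    qed (use T p p_in in \<open>auto simp: spanning_tree_def\<close>)
  qed
qed

text \<open>The least number in the definition of \<open>tour_length\<close> exists because both
  darts of every edge are reached, necessarily at different times. This guarantees that the search
  in \<open>first_vertex\<close> succeeds.\<close>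

lemma tour_length_visits:
  assumes T: "spanning_tree G T" and p: "p \<in> darts" and f: "f \<in> edges G"
  shows "\<exists>i<tour_length G \<rho> p T. snd (tour_at G \<rho> p T i) = f"
proof -
  have "\<exists>n. \<forall>m\<ge>n. 2 \<le> card {i. i < m \<and> snd (tour_at G \<rho> p T i) = f}" if "f \<in> edges G" for f
  proof -
    have "(tail G f, f) \<in> darts" "(head G f, f) \<in> darts"
      using that by (auto simp: darts_iff)
    then obtain i j where ij: "tour_at G \<rho> p T i = (tail G f, f)" "tour_at G \<rho> p T j = (head G f, f)"
      unfolding tour_range[OF T p, symmetric] by (metis rangeE)
    then have "i \<noteq> j"
      using no_loops[OF that] by auto
    show ?thesis
    proof (intro exI[of _ "Suc (max i j)"] allI impI)
      fix m assume "Suc (max i j) \<le> m"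
      then have "card {i, j} \<le> card {i. i < m \<and> snd (tour_at G \<rho> p T i) = f}"
        using ij by (intro card_mono) auto
      then show "2 \<le> card {i. i < m \<and> snd (tour_at G \<rho> p T i) = f}"
        using \<open>i \<noteq> j\<close> by simp
    qed
  qed
  then obtain n where n: "\<And>f m. f \<in> edges G \<Longrightarrow> n f \<le> m \<Longrightarrow>
      2 \<le> card {i. i < m \<and> snd (tour_at G \<rho> p T i) = f}"
    by metis
  have "\<forall>f\<in>edges G. 2 \<le> card {i. i < Max (range n) \<and> snd (tour_at G \<rho> p T i) = f}"
    by (intro ballI n) auto
  then have "\<forall>f\<in>edges G. 2 \<le> card {i. i < tour_length G \<rho> p T \<and> snd (tour_at G \<rho> p T i) = f}"
    unfolding tour_length_def by (rule LeastI)
  then have "2 \<le> card {i. i < tour_length G \<rho> p T \<and> snd (tour_at G \<rho> p T i) = f}"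
    using f by blast
  then have "{i. i < tour_length G \<rho> p T \<and> snd (tour_at G \<rho> p T i) = f} \<noteq> {}"
    by (metis card.empty not_numeral_le_zero)
  then show ?thesis by blast
qed

lemma first_vertex:
  assumes "spanning_tree G T" "p \<in> darts" "f \<in> edges G"
  obtains i where "tour_at G \<rho> p T i = (first_vertex G \<rho> p T f, f)"
    "\<And>j. j < i \<Longrightarrow> snd (tour_at G \<rho> p T j) \<noteq> f"
proof -
  let ?tour = "map (tour_at G \<rho> p T) [0..<tour_length G \<rho> p T]"
  have "find (\<lambda>q. snd q = f) ?tour \<noteq> None"
    using tour_length_visits[OF assms] unfolding find_None_iff by fastforce
  then obtain q where q: "find (\<lambda>q. snd q = f) ?tour = Some q" by blast
  then obtain i where i: "i < tour_length G \<rho> p T" "snd (tour_at G \<rho> p T i) = f" "q = tour_at G \<rho> p T i"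
    "\<And>j. j < i \<Longrightarrow> snd (tour_at G \<rho> p T j) \<noteq> f"
    by (auto simp: find_Some_iff)
  moreover have "first_vertex G \<rho> p T f = fst q"
    using q by (simp add: first_vertex_def tour_def)
  ultimately show ?thesis
    using that[of i] by (simp add: prod_eq_iff)
qed

lemma first_vertex_eq_head_in_cycle:
  assumes T: "spanning_tree G T" and p: "p \<in> darts" and f: "f \<in> edges G - T"
    and D: "oriented_cycle G D" "fst ` D \<subseteq> insert f T" "f \<in> fst ` D"
    and k: "dual_potential (chain D) k" "\<And>u x. (u, x) \<in> darts \<Longrightarrow> 0 \<le> k u x" "k (fst p) (snd p) = 0"
  shows "first_vertex G \<rho> p T f = head_in_cycle G D f"
proof -
  define x where "x = first_vertex G \<rho> p T f"
  obtain i where i: "tour_at G \<rho> p T i = (x, f)" "\<And>j. j < i \<Longrightarrow> snd (tour_at G \<rho> p T j) \<noteq> f"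
    using first_vertex[OF T p] f unfolding x_def by blast
  have "k (fst (tour_at G \<rho> p T j)) (snd (tour_at G \<rho> p T j)) = 0" if "j \<le> i" for j
    using that
  proof (induction j)
    case 0
    then show ?case using k(3) by (simp add: tour_at_def)
  next
    case (Suc j)
    obtain u y where uy: "tour_at G \<rho> p T j = (u, y)" by fastforce
    then have "(u, y) \<in> darts" "y \<noteq> f" "k u y = 0"
      using tour_at_in_darts[OF p] Suc i(2)[of j] by (metis, auto)
    then show ?case
    proof (cases "y \<in> T")
      \<comment> \<open>The tour follows one side of the tree edge \<open>y\<close>, even if
        \<open>y\<close> belongs to \<open>D\<close>, and \<open>k\<close> has the same value at
        both ends of that side.\<close>
      case True
      then show ?thesis
        using dual_potential_other_end[OF k(1) \<open>(u, y) \<in> darts\<close>] \<open>k u y = 0\<close> uy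
        by (simp add: tour_at_Suc tour_step_eq)
    next
      case False
      then have "chain D $ y = 0"
        using oriented_cycle_chain_nth_eq_0_iff[OF D(1)] D(2) \<open>y \<noteq> f\<close> by blast
      then show ?thesis
        using dual_potential_rho[OF k(1) \<open>(u, y) \<in> darts\<close>] \<open>k u y = 0\<close> uy False
        by (simp add: tour_at_Suc tour_step_eq)
    qed
  qed
  from this[of i] have "k x f = 0"
    using i by simp
  moreover have xf: "(x, f) \<in> darts"
    using tour_at_in_darts[OF p, of T i] i by simp
  \<comment> \<open>The corner after \<open>f\<close> has a nonnegative value and the corner before
    it has value 0, so the jump at \<open>f\<close> is not -1. It is 1 precisely at the head of
    \<open>f\<close> in \<open>D\<close>.\<close>
  ultimately have "0 \<le> (if x = head G f then chain D $ f else - chain D $ f)"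
    using dual_potential_rho[OF k(1) xf] k(2)[OF rho_in_darts[OF xf]] by simp
  moreover obtain b where b: "(f, b) \<in> D"
    using D(3) by force
  ultimately have "x = oedge_target G (f, b)"
    using oriented_cycle_chain_nth[OF D(1) b] xf by (auto simp: oedge_target_def darts_iff split: if_splits)
  moreover have "(THE d. d \<in> D \<and> fst d = f) = (f, b)"
    using b inj_onD[OF oriented_cycle_inj_fst[OF D(1)]] by (intro the_equality) auto
  ultimately show ?thesis
    by (simp add: head_in_cycle_def x_def)
qed

theorem geometric_bernardi_if_dual_potentials:
  assumes p: "p \<in> darts"
    and ex: "\<And>C. is_cycle G C \<Longrightarrow> \<exists>D k. oriented_cycle G D \<and> fst ` D = C \<and> dual_potential (chain D) k \<and>
      (\<forall>(u, x)\<in>darts. 0 \<le> k u x) \<and> k (fst p) (snd p) = 0"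
  shows "geometric_cycle_orientation_map G (bernardi G \<rho> p)"
proof -
  obtain \<sigma> k where \<sigma>: "\<And>C. is_cycle G C \<Longrightarrow> oriented_cycle G (\<sigma> C) \<and> fst ` \<sigma> C = C \<and>
      dual_potential (chain (\<sigma> C)) (k C) \<and> (\<forall>(u, x)\<in>darts. 0 \<le> k C u x) \<and> k C (fst p) (snd p) = 0"
    using ex by metis
  have "geometric_configuration G \<sigma>"
  proof -
    define S where "S = chain ` \<sigma> ` Collect (is_cycle G)"
    have "finite S" by (simp add: S_def)
    have "0 \<notin> convex hull S"
    proof
      assume "0 \<in> convex hull S"
      then obtain c where c: "\<And>z. z \<in> S \<Longrightarrow> 0 \<le> c z" "sum c S = 1" "(\<Sum>z\<in>S. c z *\<^sub>R z) = 0"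
        unfolding convex_hull_finite[OF \<open>finite S\<close>] by auto
      \<comment> \<open>One potential is chosen for each vector of \<open>S\<close> rather than for
        each cycle, to match the sum over \<open>S\<close> in the convex combination.\<close>
      have "\<forall>z\<in>S. \<exists>k. z \<noteq> 0 \<and> dual_potential z k \<and> (\<forall>(u, x)\<in>darts. 0 \<le> k u x) \<and> k (fst p) (snd p) = 0"
      proof
        fix z assume "z \<in> S"
        then obtain C where C: "is_cycle G C" "z = chain (\<sigma> C)" by (auto simp: S_def)
        have "oriented_cycle G (\<sigma> C)"
          using \<sigma>[OF C(1)] by simp
        then obtain y where "y \<in> fst ` \<sigma> C"
          using oriented_cycle_nonempty[of G "\<sigma> C"] by fastforce
        then have "z \<noteq> 0"
          using oriented_cycle_chain_nth_eq_0_iff[OF \<open>oriented_cycle G (\<sigma> C)\<close>, of y] C(2) by auto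
        then show "\<exists>k. z \<noteq> 0 \<and> dual_potential z k \<and> (\<forall>(u, x)\<in>darts. 0 \<le> k u x) \<and> k (fst p) (snd p) = 0"
          using \<sigma>[OF C(1)] C(2) by (intro exI[of _ "k C"]) simp
      qed
      then obtain l where "\<forall>z\<in>S. z \<noteq> 0 \<and> dual_potential z (l z) \<and>
          (\<forall>(u, x)\<in>darts. 0 \<le> l z u x) \<and> l z (fst p) (snd p) = 0"
        unfolding bchoice_iff by blast
      then have l: "\<And>z. z \<in> S \<Longrightarrow> z \<noteq> 0" "\<And>z. z \<in> S \<Longrightarrow> dual_potential z (l z)"
        "\<And>z u x. z \<in> S \<Longrightarrow> (u, x) \<in> darts \<Longrightarrow> 0 \<le> l z u x" "\<And>z. z \<in> S \<Longrightarrow> l z (fst p) (snd p) = 0"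
        by auto
      have pot: "dual_potential 0 (\<lambda>u x. \<Sum>z\<in>S. c z * l z u x)"
        using dual_potential_sum[of S "\<lambda>z. z" l c] l(2) c(3) by simp
      obtain z where z: "z \<in> S" "0 < c z"
        using c(1,2) by (metis less_eq_real_def sum.neutral zero_neq_one)
      have l0: "l z u x = 0" if ux: "(u, x) \<in> darts" for u x
      proof -
        have "(\<Sum>z\<in>S. c z * l z u x) = (\<Sum>z\<in>S. c z * l z (fst p) (snd p))"
          using dual_potential_0_constant[OF pot _ ux] p by simp
        also have "\<dots> = 0"
          using l(4) by simp
        finally have "\<forall>z\<in>S. c z * l z u x = 0"
          using l(3)[OF _ ux] c(1) \<open>finite S\<close> by (simp add: sum_nonneg_eq_0_iff)
        then show ?thesis using z by fastforce
      qed
      obtain C where C: "is_cycle G C" "z = chain (\<sigma> C)" using z by (auto simp: S_def)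
      \<comment> \<open>The entries of \<open>z\<close> are the jumps of \<open>l z\<close>, which
        vanishes on all darts.\<close>
      have "z $ x = 0" for x
      proof (cases "x \<in> edges G")
        case True
        then have "(head G x, x) \<in> darts" by (simp add: darts_iff)
        then show ?thesis
          using dual_potential_rho[OF l(2)[OF z(1)]] l0 rho_in_darts by fastforce
      next
        case False
        then show ?thesis
          using oriented_cycle_chain_nth_eq_0_iff[of G "\<sigma> C" x] oriented_cycle_edges[of G "\<sigma> C"] \<sigma>[OF C(1)] C(2)
          by auto
      qed
      then show False
        using l(1)[OF z(1)] by (simp add: vec_eq_iff)
    qed
    show ?thesis
    proof (cases "S = {}")
      \<comment> \<open>If there are no cycles, the hull is empty and has no closest point, but
        every vector of \<open>H1 G\<close> will do.\<close>
      case True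
      then show ?thesis
        unfolding geometric_configuration_def by (intro bexI[of _ 0]) (auto simp: S_def H1_def span_0)
    next
      case False
      let ?H = "convex hull S"
      have H: "closed ?H" "?H \<noteq> {}" "convex ?H"
        using \<open>finite S\<close> False by (auto simp: finite_imp_compact_convex_hull compact_imp_closed)
      define w where "w = closest_point ?H 0"
      have w: "w \<in> ?H"
        unfolding w_def using H by (intro closest_point_in_set)
      have "S \<subseteq> H1 G"
        using \<sigma> by (auto simp: S_def H1_def intro!: span_base)
      then have "?H \<subseteq> H1 G"
        unfolding H1_def by (intro hull_minimal) (auto simp: subspace_imp_convex)
      moreover have "0 < inner w (chain (\<sigma> C))" if "is_cycle G C" for C
      proof -
        have "chain (\<sigma> C) \<in> ?H"
          using that by (auto simp: S_def intro: hull_inc)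
        \<comment> \<open>The variational inequality for the closest point; it yields
          \<open>inner w w\<close> as a common positive lower bound.\<close>
        then have "inner (0 - w) (chain (\<sigma> C) - w) \<le> 0"
          unfolding w_def using H by (intro closest_point_dot)
        then have "inner w w \<le> inner w (chain (\<sigma> C))"
          by (simp add: inner_diff_right)
        moreover have "0 < inner w w"
          using w \<open>0 \<notin> ?H\<close> by auto
        ultimately show ?thesis by (rule less_le_trans[rotated])
      qed
      ultimately show ?thesis
        using w unfolding geometric_configuration_def by blast
    qed
  qed
  moreover have "cycle_orientation_configuration G \<sigma>"
    using \<sigma> by (simp add: cycle_orientation_configuration_def)
  moreover have "bernardi G \<rho> p T = cycle_orientation_map G \<sigma> T" if T: "spanning_tree G T" for T
  proof -
    have "first_vertex G \<rho> p T f = head_in_cycle G (\<sigma> (fundamental_cycle G T f)) f"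
      if f: "f \<in> edges G - T" for f
    proof -
      note C = fundamental_cycle[OF T f]
      show ?thesis
        using \<sigma>[OF C(1)] C(2,3)
        by (intro first_vertex_eq_head_in_cycle[OF T p f, where k = "k (fundamental_cycle G T f)"]) auto
    qed
    then show ?thesis
      by (simp add: bernardi_def cycle_orientation_map_def)
  qed
  ultimately show ?thesis
    unfolding geometric_cycle_orientation_map_def by blast
qed

end


section \<open>Winding numbers on the two sides of a loop\<close>

definition exit_time :: "(real \<Rightarrow> complex) \<Rightarrow> complex \<Rightarrow> real \<Rightarrow> real" where
  "exit_time g v r = Inf {t \<in> {0..1}. g t \<in> sphere v r}"

text \<open>The parameters on the sphere form a nonempty closed set, so the infimum is attained; by
  the intermediate value theorem nothing before it lies outside the ball. Nothing is claimed about
  later times, when the path may come back.\<close>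

lemma exit_time:
  assumes "path g" "pathstart g = v" "0 < r" "r \<le> dist v (pathfinish g)"
  shows "0 < exit_time g v r" "exit_time g v r \<le> 1" "g (exit_time g v r) \<in> sphere v r"
    "\<And>t. 0 \<le> t \<Longrightarrow> t < exit_time g v r \<Longrightarrow> g t \<in> ball v r"
proof -
  define X where "X = {t \<in> {0..1}. g t \<in> sphere v r}"
  have cont: "continuous_on {0..1} (\<lambda>t. dist v (g t))"
    using assms(1) by (auto simp: path_def intro!: continuous_intros)
  have X_eq: "X = {0..1} \<inter> (\<lambda>t. dist v (g t)) -` {r}"
    by (auto simp: X_def)
  have "closed X"
    unfolding X_eq using cont by (intro continuous_closed_preimage) auto
  have g0: "dist v (g 0) = 0"
    using assms(2) by (simp add: pathstart_def)
  have ivt: "\<exists>x\<in>X. x \<le> t" if "0 \<le> t" "t \<le> 1" "r \<le> dist v (g t)" for t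
  proof -
    have "\<exists>x\<ge>0. x \<le> t \<and> dist v (g x) = r"
      using that g0 assms(3) by (intro IVT' continuous_on_subset[OF cont]) auto
    then show ?thesis
      using that by (auto simp: X_eq)
  qed
  have "X \<noteq> {}"
    using ivt[of 1] assms(4) by (auto simp: pathfinish_def)
  moreover have bdd: "bdd_below X"
    by (rule bdd_belowI[of _ 0]) (auto simp: X_def)
  ultimately have "Inf X \<in> X"
    using closed_contains_Inf \<open>closed X\<close> by blast
  then have mem: "exit_time g v r \<in> X"
    by (simp add: exit_time_def X_def)
  then show "exit_time g v r \<le> 1" "g (exit_time g v r) \<in> sphere v r"
    by (auto simp: X_def)
  show "0 < exit_time g v r"
    using mem g0 assms(3) by (cases "exit_time g v r = 0") (auto simp: X_eq)
  fix t assume t: "0 \<le> t" "t < exit_time g v r"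
  show "g t \<in> ball v r"
  proof (rule ccontr)
    assume "g t \<notin> ball v r"
    then obtain x where "x \<in> X" "x \<le> t"
      using ivt[of t] t mem by (auto simp: X_def)
    moreover have "exit_time g v r \<le> x"
      unfolding exit_time_def X_def[symmetric] using \<open>x \<in> X\<close> bdd by (rule cInf_lower)
    ultimately show False using t by simp
  qed
qed

lemma exit_time_less_1:
  assumes "path g" "pathstart g = v" "0 < r" "r < dist v (pathfinish g)"
  shows "exit_time g v r < 1"
  using exit_time[of g v r] assms by (cases "exit_time g v r = 1") (auto simp: pathfinish_def)

lemma path_image_subpath_exit_time:
  assumes "path g" "pathstart g = v" "0 < r" "r \<le> dist v (pathfinish g)"
  shows "path_image (subpath 0 (exit_time g v r) g) \<subseteq> insert (g (exit_time g v r)) (ball v r)"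
proof -
  have "path_image (subpath 0 (exit_time g v r) g) = g ` {0..exit_time g v r}"
    using exit_time(1)[OF assms] by (simp add: path_image_subpath)
  then show ?thesis
    using exit_time(4)[OF assms] by force
qed

text \<open>The rest of an arc may re-enter the disc, but by injectivity it misses the centre, and
  hence a small ball around it.\<close>

lemma path_image_subpath_after_exit_time:
  assumes "arc g" "pathstart g = v" "0 < r" "r \<le> dist v (pathfinish g)"
  shows "v \<notin> path_image (subpath (exit_time g v r) 1 g)"
proof -
  note e = exit_time[OF arc_imp_path[OF assms(1)] assms(2-4)]
  have "path_image (subpath (exit_time g v r) 1 g) = g ` {exit_time g v r..1}"
    using e(2) by (simp add: path_image_subpath)
  moreover have "g 0 \<noteq> g t" if "t \<in> {exit_time g v r..1}" for t
    using that e(1) assms(1) inj_onD[of g "{0..1}" 0 t] by (auto simp: arc_def)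
  ultimately show ?thesis
    using assms(2) unfolding pathstart_def by (metis imageE)
qed

lemma path_image_subpath_split:
  assumes "0 \<le> t" "t \<le> 1"
  shows "path_image g = path_image (subpath 0 t g) \<union> path_image (subpath t 1 g)"
proof -
  have "{0..t} \<union> {t..1} = {0..1}"
    using assms by auto
  then show ?thesis
    using assms by (simp add: path_image_subpath flip: image_Un) (simp add: path_image_def)
qed

text \<open>The ray from \<open>v\<close> through \<open>s\<close> leads from \<open>s\<close> to
  the outside of the disc without meeting \<open>K\<close>; \<open>z\<close> is its point at
  distance \<open>2 * r\<close>.\<close>

lemma winding_number_sphere_eq_0:
  assumes "path K" "pathfinish K = pathstart K" "path_image K \<subseteq> cball v r"
    and "s \<in> sphere v r" "s \<notin> path_image K" "0 < r"
  shows "winding_number K s = 0"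
proof -
  define z where "z = v + 2 * (s - v)"
  have outer: "dist v x \<ge> r \<and> (dist v x = r \<longrightarrow> x = s)" if x: "x \<in> closed_segment s z" for x
  proof -
    obtain u where u: "0 \<le> u" "u \<le> 1" "x = (1 - u) *\<^sub>R s + u *\<^sub>R z"
      using x by (auto simp: closed_segment_def)
    have "x - v = (1 + u) *\<^sub>R (s - v)"
      unfolding u(3) z_def by (simp add: scaleR_conv_of_real algebra_simps)
    moreover have "norm (s - v) = r"
      using assms(4) by (simp add: dist_norm norm_minus_commute)
    ultimately have "norm (x - v) = (1 + u) * r"
      using u(1) by simp
    then have "dist v x = (1 + u) * r"
      by (simp add: dist_norm norm_minus_commute)
    moreover have "u = 0 \<Longrightarrow> x = s"
      using u by simp
    ultimately show ?thesis
      using u assms(6) by (auto simp: mult_le_cancel_right1)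
  qed
  have "closed_segment s z \<inter> path_image K = {}"
    using outer assms(3,5) by (force simp: subset_iff)
  then have "winding_number K s = winding_number K z"
    using winding_number_eq[OF assms(1,2), of s "closed_segment s z" z] by simp
  also have "\<dots> = 0"
  proof (rule winding_number_zero_outside[OF assms(1) convex_cball assms(2) _ assms(3)])
    have "norm (s - v) = r"
      using assms(4) by (simp add: dist_norm norm_minus_commute)
    moreover have "z - v = 2 * (s - v)"
      by (simp add: z_def)
    ultimately have "dist v z = 2 * r"
      by (metis dist_norm norm_minus_commute norm_mult norm_numeral)
    then show "z \<notin> cball v r"
      using assms(6) by simp
  qed
  finally show ?thesis .
qed

text \<open>A loop that leaves \<open>v\<close> along \<open>G\<close>, follows \<open>N\<close> and
  comes back along the reverse of \<open>F\<close>. Here \<open>G\<close> is an arc, not a graph;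
  both \<open>G\<close> and \<open>F\<close> are parametrised away from \<open>v\<close>, whence the
  minus signs below. The arcs may share their far ends, and \<open>N\<close> may be constant, so
  that two parallel edges are covered.\<close>

locale loop_at =
  fixes G F N :: "real \<Rightarrow> complex" and v :: complex and r :: real
  assumes arcs: "arc G" "arc F" and N: "path N" "v \<notin> path_image N"
    and ends: "pathstart G = v" "pathstart F = v" "pathstart N = pathfinish G" "pathfinish N = pathfinish F"
    and G_Int_F: "path_image G \<inter> path_image F \<subseteq> {v, pathfinish G}"
    and radius: "0 < r" "r < dist v (pathfinish G)" "r < dist v (pathfinish F)"
begin

definition loop_image :: "complex set" where
  "loop_image = path_image G \<union> path_image N \<union> path_image F"

definition winding :: "complex \<Rightarrow> complex" where
  "winding x = winding_number G x + winding_number N x - winding_number F x"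

definition G_exit :: complex where "G_exit = G (exit_time G v r)"

definition F_exit :: complex where "F_exit = F (exit_time F v r)"

text \<open>The contribution at \<open>v\<close> of the loop between its two exit points. This part
  is not closed; a circular arc from \<open>F_exit\<close> to \<open>G_exit\<close> has to be added
  to obtain the winding number of a closed curve.\<close>

definition winding_rest :: complex where
  "winding_rest = winding_number (subpath (exit_time G v r) 1 G) v + winding_number N v
     - winding_number (subpath (exit_time F v r) 1 F) v"

lemma paths: "path G" "path F"
  using arcs by (auto intro: arc_imp_path)

lemma radius_le: "r \<le> dist v (pathfinish G)" "r \<le> dist v (pathfinish F)"
  using radius by auto

lemma winding_eq_loop:
  assumes "x \<notin> loop_image"
  shows "winding x = winding_number (G +++ N +++ reversepath F) x"
  using assms paths N ends
  by (simp add: loop_image_def winding_def winding_number_join winding_number_reversepath path_image_join)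

lemma winding_eq_if_connected:
  assumes "connected S" "S \<inter> loop_image = {}" "x \<in> S" "y \<in> S"
  shows "winding x = winding y"
proof -
  have "winding_number (G +++ N +++ reversepath F) x = winding_number (G +++ N +++ reversepath F) y"
    using assms paths N ends
    by (intro winding_number_eq[of _ _ S]) (auto simp: loop_image_def path_image_join)
  moreover have "x \<notin> loop_image" "y \<notin> loop_image"
    using assms by auto
  ultimately show ?thesis
    by (simp add: winding_eq_loop)
qed

lemma exits_on_sphere: "G_exit \<in> sphere v r" "F_exit \<in> sphere v r"
  using exit_time(3)[OF paths(1) ends(1) radius(1) radius_le(1)]
    exit_time(3)[OF paths(2) ends(2) radius(1) radius_le(2)]
  by (auto simp: G_exit_def F_exit_def)

lemma exits_in_image: "G_exit \<in> path_image G" "F_exit \<in> path_image F"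
  using exit_time[OF paths(1) ends(1) radius(1) radius_le(1)]
    exit_time[OF paths(2) ends(2) radius(1) radius_le(2)]
  by (auto simp: G_exit_def F_exit_def path_image_def)

lemma exits_distinct: "G_exit \<noteq> F_exit"
  using exits_in_image exits_on_sphere G_Int_F radius by auto

text \<open>
  Near \<open>v\<close>, the loop is homologous to the loop \<open>K\<close> that leaves along \<open>G\<close>, follows the circular arc
  \<open>A\<close> backwards and returns along \<open>F\<close>, plus the loop formed by the rest of the curve and \<open>A\<close>. The
  latter avoids a neighbourhood of \<open>v\<close>.
\<close>

lemma close_up:
  assumes A: "arc A" "path_image A \<subseteq> sphere v r" "pathstart A = F_exit" "pathfinish A = G_exit"
  obtains K \<delta> where "simple_path K" "pathfinish K = pathstart K" "path_image K \<subseteq> cball v r"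
    "path_image K \<subseteq> path_image G \<union> path_image F \<union> path_image A" "v \<in> path_image K"
    "0 < \<delta>" "\<delta> \<le> r"
    "\<And>x. x \<in> ball v \<delta> \<Longrightarrow> x \<notin> path_image K \<Longrightarrow>
       x \<notin> loop_image \<and> winding x = winding_rest + winding_number A v + winding_number K x"
proof -
  define \<tau> where "\<tau> = exit_time G v r"
  define \<upsilon> where "\<upsilon> = exit_time F v r"
  note \<tau> = exit_time[OF paths(1) ends(1) radius(1) radius_le(1), folded \<tau>_def]
  note \<upsilon> = exit_time[OF paths(2) ends(2) radius(1) radius_le(2), folded \<upsilon>_def]
  have lt1: "\<tau> < 1" "\<upsilon> < 1"
    using exit_time_less_1 paths ends radius by (auto simp: \<tau>_def \<upsilon>_def)
  define G0 G1 F0 F1 where "G0 = subpath 0 \<tau> G" and "G1 = subpath \<tau> 1 G"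
    and "F0 = subpath 0 \<upsilon> F" and "F1 = subpath \<upsilon> 1 F"
  note sub_defs = G0_def G1_def F0_def F1_def
  have arcs_sub: "arc G0" "arc F0"
    using arcs \<tau> \<upsilon> by (auto simp: sub_defs intro!: arc_subpath_arc)
  have paths_sub: "path G0" "path F0" "path G1" "path F1" "path A"
    using paths \<tau> \<upsilon> A(1) by (auto simp: sub_defs intro!: path_subpath arc_imp_path)
  have ends_sub: "pathstart G0 = v" "pathfinish G0 = G_exit" "pathstart G1 = G_exit"
    "pathfinish G1 = pathfinish G" "pathstart F0 = v" "pathfinish F0 = F_exit"
    "pathstart F1 = F_exit" "pathfinish F1 = pathfinish F"
    using ends by (auto simp: sub_defs G_exit_def F_exit_def \<tau>_def \<upsilon>_def pathstart_def pathfinish_def subpath_def)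
  have im: "path_image G = path_image G0 \<union> path_image G1" "path_image F = path_image F0 \<union> path_image F1"
    using \<tau> \<upsilon> by (auto simp: sub_defs intro!: path_image_subpath_split)
  have G0: "path_image G0 \<subseteq> insert G_exit (ball v r)"
    unfolding sub_defs \<tau>_def G_exit_def
    using path_image_subpath_exit_time[OF paths(1) ends(1) radius(1) radius_le(1)] .
  have F0: "path_image F0 \<subseteq> insert F_exit (ball v r)"
    unfolding sub_defs \<upsilon>_def F_exit_def
    using path_image_subpath_exit_time[OF paths(2) ends(2) radius(1) radius_le(2)] .
  have v1: "v \<notin> path_image G1" "v \<notin> path_image F1"
    using path_image_subpath_after_exit_time arcs ends radius(1) radius_le
    by (auto simp: sub_defs \<tau>_def \<upsilon>_def)
  have G0_Int_F0: "path_image G0 \<inter> path_image F0 \<subseteq> {v}"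
  proof -
    have "pathfinish G \<notin> path_image G0"
      using G0 exits_on_sphere radius by auto
    then show ?thesis
      using G_Int_F im by auto
  qed
  have A_sphere: "x \<notin> ball v r" if "x \<in> path_image A" for x
    using that A(2) by auto
  \<comment> \<open>\<open>Q\<close> is closed and avoids \<open>v\<close>, since \<open>G1\<close>
    and \<open>F1\<close> start after the exit and \<open>A\<close> lies on the sphere. So its
    winding number is constant near \<open>v\<close>.\<close>
  define Q where "Q = G1 +++ N +++ reversepath F1 +++ A"
  have Q: "path Q" "pathfinish Q = pathstart Q"
    "path_image Q = path_image G1 \<union> path_image N \<union> path_image F1 \<union> path_image A"
    using paths_sub ends_sub ends N A by (auto simp: Q_def path_image_join)
  have wQ: "winding_number Q x =
      winding_number G1 x + winding_number N x - winding_number F1 x + winding_number A x"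
    if "x \<notin> path_image Q" for x
    using that unfolding Q(3) Q_def
    using paths_sub ends_sub ends N A
    by (simp add: winding_number_join winding_number_reversepath path_image_join)
  have vQ: "v \<notin> path_image Q"
    using v1 N A(2) radius by (auto simp: Q(3))
  have "open (- path_image Q)"
    using closed_path_image[OF Q(1)] by auto
  then obtain \<delta>0 where \<delta>0: "0 < \<delta>0" "ball v \<delta>0 \<subseteq> - path_image Q"
    using vQ by (auto simp: open_contains_ball)
  define \<delta> where "\<delta> = min \<delta>0 r"
  have \<delta>: "0 < \<delta>" "\<delta> \<le> r" "ball v \<delta> \<inter> path_image Q = {}"
    using \<delta>0 radius by (auto simp: \<delta>_def)
  \<comment> \<open>The initial pieces meet the sphere only in their exit points and each other only
    in \<open>v\<close>, which makes \<open>K\<close> a simple closed curve.\<close>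
  define K where "K = (G0 +++ reversepath A) +++ reversepath F0"
  have K_arc: "arc (G0 +++ reversepath A)"
    using arcs_sub A ends_sub G0 A_sphere by (intro arc_join) (auto simp: arc_reversepath)
  have K: "simple_path K"
    unfolding K_def
  proof (rule simple_path_join_loop[OF K_arc])
    show "path_image (G0 +++ reversepath A) \<inter> path_image (reversepath F0)
        \<subseteq> {pathstart (G0 +++ reversepath A), pathstart (reversepath F0)}"
      using G0_Int_F0 F0 A_sphere A ends_sub by (auto simp: path_image_join)
  qed (use arcs_sub A ends_sub in \<open>auto simp: arc_reversepath\<close>)
  have K_image: "path_image K = path_image G0 \<union> path_image A \<union> path_image F0"
    using ends_sub A by (simp add: K_def path_image_join)
  have wK: "winding_number K x = winding_number G0 x - winding_number A x - winding_number F0 x"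
    if "x \<notin> path_image K" for x
    using that unfolding K_image K_def using paths_sub ends_sub A
    by (simp add: winding_number_join winding_number_reversepath path_image_join)
  show ?thesis
  proof (rule that[of K \<delta>])
    show "path_image K \<subseteq> cball v r"
      using G0 F0 A(2) exits_on_sphere by (force simp: K_image subset_iff)
    show "path_image K \<subseteq> path_image G \<union> path_image F \<union> path_image A"
      using im by (auto simp: K_image)
    show "v \<in> path_image K"
      using ends_sub pathstart_in_path_image[of G0] by (auto simp: K_image)
    show "x \<notin> loop_image \<and> winding x = winding_rest + winding_number A v + winding_number K x"
      if x: "x \<in> ball v \<delta>" "x \<notin> path_image K" for x
    proof
      have xQ: "x \<notin> path_image Q"
        using x \<delta> by blast
      then show "x \<notin> loop_image"
        using x by (auto simp: loop_image_def im Q(3) K_image)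
      have wQ_eq: "winding_number Q x = winding_number Q v"
        using winding_number_eq[OF Q(1,2), of x "ball v \<delta>" v] x \<delta> by simp
      have wG: "winding_number G x = winding_number G0 x + winding_number G1 x"
        using winding_number_subpath_combine[of G x 0 \<tau> 1, folded sub_defs] x xQ \<tau>(1,2) paths(1)
        by (simp add: im Q(3) K_image)
      have wF: "winding_number F x = winding_number F0 x + winding_number F1 x"
        using winding_number_subpath_combine[of F x 0 \<upsilon> 1, folded sub_defs] x xQ \<upsilon>(1,2) paths(2)
        by (simp add: im Q(3) K_image)
      \<comment> \<open>\<open>A\<close> is traversed forwards in \<open>Q\<close> and backwards in
        \<open>K\<close>, so its contributions cancel.\<close>
      have "winding x = winding_number Q x + winding_number K x"
        by (simp add: winding_def wG wF wQ[OF xQ] wK[OF x(2)])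
      also have "winding_number Q x = winding_rest + winding_number A v"
        by (simp add: wQ_eq wQ[OF vQ] winding_rest_def \<tau>_def \<upsilon>_def G1_def F1_def)
      finally show "winding x = winding_rest + winding_number A v + winding_number K x" .
    qed
  qed (use K \<delta> ends_sub in \<open>auto simp: K_def\<close>)
qed

text \<open>By the Jordan curve theorem, \<open>v\<close> is a frontier point of the outside of
  \<open>K\<close>, so points with winding number 0 around \<open>K\<close> occur arbitrarily close
  to \<open>v\<close>.\<close>

lemma side_value_attained:
  assumes A: "arc A" "path_image A \<subseteq> sphere v r" "pathstart A = F_exit" "pathfinish A = G_exit"
  obtains x where "x \<notin> loop_image" "winding x = winding_rest + winding_number A v"
proof -
  obtain K \<delta> where K: "simple_path K" "pathfinish K = pathstart K" "v \<in> path_image K" "0 < \<delta>"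
    and near: "\<And>x. x \<in> ball v \<delta> \<Longrightarrow> x \<notin> path_image K \<Longrightarrow>
       x \<notin> loop_image \<and> winding x = winding_rest + winding_number A v + winding_number K x"
    using close_up[OF A] by metis
  have "v \<in> frontier (outside (path_image K))"
    using Jordan_inside_outside[OF K(1,2)] K(3) by simp
  then have "v \<in> closure (outside (path_image K))"
    by (simp add: frontier_def)
  then obtain x where x: "x \<in> outside (path_image K)" "dist x v < \<delta>"
    using K(4) by (auto simp: closure_approachable)
  then have "x \<notin> path_image K"
    using outside_no_overlap by blast
  moreover have "winding_number K x = 0"
    using winding_number_zero_in_outside[OF simple_path_imp_path[OF K(1)] K(2) x(1)] .
  ultimately show ?thesis
    using near[of x] x that[of x] by (simp add: dist_commute)
qed

text \<open>The formula of \<open>close_up\<close> holds only near \<open>v\<close>. Up to its exit,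
  \<open>E\<close> meets neither the loop nor \<open>K\<close>, so both winding numbers can be
  carried from a point near \<open>v\<close> to the exit point, and there the one of
  \<open>K\<close> is 0.\<close>

lemma winding_exit_point:
  assumes A: "arc A" "path_image A \<subseteq> sphere v r" "pathstart A = F_exit" "pathfinish A = G_exit"
    and E: "path E" "pathstart E = v" "r \<le> dist v (pathfinish E)"
    and avoid: "\<And>t. 0 < t \<Longrightarrow> t \<le> exit_time E v r \<Longrightarrow> E t \<notin> loop_image"
    and s: "E (exit_time E v r) \<notin> path_image A"
  shows "winding (E (exit_time E v r)) = winding_rest + winding_number A v"
proof -
  obtain K \<delta> where K: "simple_path K" "pathfinish K = pathstart K" "path_image K \<subseteq> cball v r"
      "path_image K \<subseteq> path_image G \<union> path_image F \<union> path_image A" "0 < \<delta>"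
    and near: "\<And>x. x \<in> ball v \<delta> \<Longrightarrow> x \<notin> path_image K \<Longrightarrow>
       x \<notin> loop_image \<and> winding x = winding_rest + winding_number A v + winding_number K x"
    using close_up[OF A] by metis
  define \<tau> where "\<tau> = exit_time E v r"
  note \<tau> = exit_time[OF E(1,2) radius(1) E(3), folded \<tau>_def]
  have avoid_K: "E t \<notin> path_image K" if "0 < t" "t \<le> \<tau>" for t
  proof -
    have "E t \<notin> path_image A"
      using that s \<tau>(4)[of t] A(2) by (cases "t = \<tau>") (auto simp: \<tau>_def)
    then show ?thesis
      using avoid[of t] that K(4) by (auto simp: loop_image_def \<tau>_def)
  qed
  obtain d where d: "0 < d" "\<And>t. t \<in> {0..1} \<Longrightarrow> dist t 0 < d \<Longrightarrow> dist (E t) (E 0) < \<delta>"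
    using E(1) K(5) unfolding path_def continuous_on_iff by force
  \<comment> \<open>A time so early that \<open>E\<close> is still in the ball of radius
    \<open>\<delta>\<close>, and not after the exit.\<close>
  define t0 where "t0 = min (d / 2) \<tau>"
  have t0: "0 < t0" "t0 \<le> \<tau>"
    using d \<tau> by (auto simp: t0_def)
  have "t0 \<in> {0..1}"
    using t0 \<tau>(2) by simp
  moreover have "dist t0 0 < d"
    using d t0 by (auto simp: t0_def dist_real_def)
  ultimately have "E t0 \<in> ball v \<delta>"
    using d(2)[of t0] E(2) by (simp add: pathstart_def dist_commute)
  then have "winding (E t0) = winding_rest + winding_number A v + winding_number K (E t0)"
    using near[of "E t0"] avoid_K[OF t0] by simp
  moreover have "continuous_on {t0..\<tau>} E"
    using E(1) t0 \<tau>(2) by (auto simp: path_def intro: continuous_on_subset)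
  then have conn: "connected (E ` {t0..\<tau>})"
    by (rule connected_continuous_image) auto
  have "winding (E t0) = winding (E \<tau>)"
    using t0 avoid by (intro winding_eq_if_connected[OF conn]) (auto simp: \<tau>_def)
  moreover have "winding_number K (E t0) = winding_number K (E \<tau>)"
    using t0 avoid_K simple_path_imp_path[OF K(1)] K(2) conn
    by (intro winding_number_eq[of _ _ "E ` {t0..\<tau>}"]) auto
  moreover have "winding_number K (E \<tau>) = 0"
    using K \<tau>(1,3) avoid_K radius(1)
    by (intro winding_number_sphere_eq_0[of _ v r]) (auto simp: simple_path_imp_path)
  ultimately show ?thesis
    by (simp add: \<tau>_def)
qed

text \<open>
  The two circular arcs between the exit points differ by a full turn, so the values on the two sides
  differ by 1; together with the Jordan curve theorem this determines both values.
\<close>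

lemma winding_side:
  fixes \<epsilon> :: complex
  assumes eps: "\<epsilon> \<in> {1, - 1}" "\<And>x. x \<notin> loop_image \<Longrightarrow> winding x \<in> {0, \<epsilon>}"
    and E: "path E" "pathstart E = v" "r \<le> dist v (pathfinish E)"
    and avoid: "\<And>t. 0 < t \<Longrightarrow> t \<le> exit_time E v r \<Longrightarrow> E t \<notin> loop_image"
  defines "s \<equiv> E (exit_time E v r)"
  shows "winding s =
    (if Arg2pi ((s - v) / (G_exit - v)) < Arg2pi ((F_exit - v) / (G_exit - v)) then (\<epsilon> + 1) / 2 else (\<epsilon> - 1) / 2)"
proof -
  define \<alpha> where "\<alpha> = Arg2pi (G_exit - v)"
  define angle where "angle x = Arg2pi ((x - v) / (G_exit - v))" for x
  define \<theta> where "\<theta> = angle F_exit"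
  have nz: "G_exit - v \<noteq> 0"
    using exits_on_sphere radius by auto
  have angle: "x = v + r * cis (\<alpha> + angle x)" if "x \<in> sphere v r" for x
  proof -
    have norms: "norm (x - v) = r" "norm (G_exit - v) = r"
      using that exits_on_sphere by (auto simp: dist_norm norm_minus_commute)
    have "(x - v) / (G_exit - v) = cis (angle x)"
      using Arg2pi_eq[of "(x - v) / (G_exit - v)"] norms radius(1)
      by (simp add: angle_def norm_divide cis_conv_exp)
    moreover have "G_exit - v = r * cis \<alpha>"
      using Arg2pi_eq[of "G_exit - v"] norms by (simp add: \<alpha>_def cis_conv_exp)
    ultimately show ?thesis
      using nz by (simp add: field_simps flip: cis_mult)
  qed
  have angle_bounds: "0 \<le> angle x" "angle x < 2 * pi" for x
    by (auto simp: angle_def Arg2pi_ge_0 Arg2pi_lt_2pi)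
  have angle_G: "angle G_exit = 0"
    using nz Arg2pi_of_real[of 1] by (simp add: angle_def)
  have angle_inj: "x = y" if "x \<in> sphere v r" "y \<in> sphere v r" "angle x = angle y" for x y
    using angle[OF that(1)] angle[OF that(2)] that(3) by simp
  have s_sphere: "s \<in> sphere v r" and s_notin: "s \<notin> loop_image"
    using exit_time[OF E(1,2) radius(1) E(3)] avoid[of "exit_time E v r"] by (auto simp: s_def)
  have ne: "\<theta> \<noteq> 0" "angle s \<noteq> 0" "angle s \<noteq> \<theta>"
    using angle_inj[OF exits_on_sphere(2,1)] angle_inj[OF s_sphere exits_on_sphere(1)]
      angle_inj[OF s_sphere exits_on_sphere(2)] exits_distinct exits_in_image s_notin angle_G
    by (auto simp: \<theta>_def loop_image_def)
  have \<theta>: "0 < \<theta>" "\<theta> < 2 * pi"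
    using angle_bounds[of F_exit] ne by (auto simp: \<theta>_def)
  \<comment> \<open>Both arcs run from \<open>F_exit\<close> to \<open>G_exit\<close>:
    \<open>L\<close> clockwise along the sector to the left of the loop at \<open>v\<close>,
    \<open>R\<close> counter-clockwise along the one to the right. An exit point in one sector is
    treated with the arc of the other, which it avoids.\<close>
  define L where "L = reversepath (part_circlepath v r \<alpha> (\<alpha> + \<theta>))"
  define R where "R = part_circlepath v r (\<alpha> + \<theta>) (\<alpha> + 2 * pi)"
  have G_exit_eq: "G_exit = v + r * cis \<alpha>" and F_exit_eq: "F_exit = v + r * cis (\<alpha> + \<theta>)"
    using angle[OF exits_on_sphere(1)] angle[OF exits_on_sphere(2)] angle_G by (auto simp: \<theta>_def)
  have L: "arc L" "path_image L \<subseteq> sphere v r" "pathstart L = F_exit" "pathfinish L = G_exit"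
    using \<theta> radius(1) F_exit_eq G_exit_eq path_image_part_circlepath_subset'[of r v \<alpha> "\<alpha> + \<theta>"]
    by (auto simp: L_def arc_reversepath arc_part_circlepath cis_conv_exp simp del: reversepath_part_circlepath)
  have "exp (\<i> * (complex_of_real \<alpha> + 2 * of_real pi)) = cis \<alpha>"
    by (metis cis_2pi cis_conv_exp cis_mult mult.right_neutral of_real_add of_real_mult of_real_numeral)
  then have R: "arc R" "path_image R \<subseteq> sphere v r" "pathstart R = F_exit" "pathfinish R = G_exit"
    using \<theta> radius(1) F_exit_eq G_exit_eq path_image_part_circlepath_subset'[of r v "\<alpha> + \<theta>" "\<alpha> + 2 * pi"]
    by (auto simp: R_def arc_part_circlepath cis_conv_exp)
  \<comment> \<open>Along a circle about \<open>v\<close> the integrand becomes the constant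
    \<open>\<i>\<close>, so an arc contributes its angle divided by a full turn.\<close>
  have centre: "winding_number (part_circlepath v r a b) v = (b - a) / (2 * pi)" if "a < b" for a b
  proof -
    have "v \<notin> path_image (part_circlepath v r a b)"
      using radius(1) path_image_part_circlepath_subset'[of r v a b] by auto
    then have "winding_number (part_circlepath v r a b) v =
        1 / (2 * pi * \<i>) * contour_integral (part_circlepath v r a b) (\<lambda>w. 1 / (w - v))"
      by (intro winding_number_valid_path) auto
    also have "contour_integral (part_circlepath v r a b) (\<lambda>w. 1 / (w - v)) = integral {a..b} (\<lambda>t. \<i>)"
      unfolding contour_integral_part_circlepath_eq[OF that]
      using radius(1) by (intro integral_cong) simp
    also have "\<dots> = (b - a) *\<^sub>R \<i>"
      using that by simp
    finally show ?thesis
      by (simp add: scaleR_conv_of_real field_simps) (simp flip: distrib_left)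
  qed
  have "v \<notin> path_image (part_circlepath v r \<alpha> (\<alpha> + \<theta>))"
    using radius(1) path_image_part_circlepath_subset'[of r v \<alpha> "\<alpha> + \<theta>"] by auto
  then have "winding_number L v = - (\<theta> / (2 * pi))"
    using \<theta> by (simp add: L_def winding_number_reversepath centre del: reversepath_part_circlepath)
  moreover have "winding_number R v = of_real ((2 * pi - \<theta>) / (2 * pi))"
    using \<theta> by (simp add: R_def centre)
  moreover have "(2 * pi - \<theta>) / (2 * pi) = 1 - \<theta> / (2 * pi)"
    by (simp add: field_simps)
  ultimately have turn: "winding_number R v = winding_number L v + 1"
    by simp
  obtain x y where "x \<notin> loop_image" "winding x = winding_rest + winding_number L v"
    "y \<notin> loop_image" "winding y = winding_rest + winding_number R v"
    using side_value_attained[OF L] side_value_attained[OF R] by metis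
  then have vals: "winding_rest + winding_number L v \<in> {0, \<epsilon>}"
    "winding_rest + winding_number R v \<in> {0, \<epsilon>}"
    using eps(2) by metis+
  \<comment> \<open>Two elements of \<open>{0, \<epsilon>}\<close> that differ by 1 are 0 and 1 for
    \<open>\<epsilon> = 1\<close>, but -1 and 0 for \<open>\<epsilon> = - 1\<close>.\<close>
  have *: "c = (\<epsilon> - 1) / 2 \<and> c + 1 = (\<epsilon> + 1) / 2" if "c \<in> {0, \<epsilon>}" "c + 1 \<in> {0, \<epsilon>}" for c
    using that eps(1) by auto
  have sides: "winding_rest + winding_number L v = (\<epsilon> - 1) / 2"
    "winding_rest + winding_number R v = (\<epsilon> + 1) / 2"
    using *[OF vals(1)] vals(2) unfolding turn add.assoc[symmetric] by blast+
  \<comment> \<open>The second alternative covers the parameter \<open>\<alpha> + 2 * pi\<close>,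
    where the circle closes up at \<open>G_exit\<close>.\<close>
  have s_angle: "angle s = x - \<alpha> \<or> angle s = x - \<alpha> - 2 * pi"
    if "s = v + r * cis x" "\<alpha> \<le> x" "x \<le> \<alpha> + 2 * pi" for x
  proof -
    have "cis (\<alpha> + angle s) = cis x"
      using that(1) angle[OF s_sphere] radius(1) by simp
    then have "sin (\<alpha> + angle s) = sin x \<and> cos (\<alpha> + angle s) = cos x"
      by (simp add: complex_eq_iff)
    then obtain n :: int where n: "\<alpha> + angle s = x + 2 * pi * n"
      unfolding sin_cos_eq_iff by blast
    have "- 1 \<le> n" "n < 1"
    proof -
      have "2 * pi * (- 1) \<le> 2 * pi * n" "2 * pi * n < 2 * pi * 1"
        using n angle_bounds[of s] that by linarith+
      then have "- 1 \<le> real_of_int n" "real_of_int n < 1"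
        unfolding mult_le_cancel_left_pos[OF pi_gt_zero[THEN mult_pos_pos[OF zero_less_numeral]]]
          mult_less_cancel_left_pos[OF pi_gt_zero[THEN mult_pos_pos[OF zero_less_numeral]]] .
      then show "- 1 \<le> n" "n < 1"
        by linarith+
    qed
    then have "n = - 1 \<or> n = 0" by linarith
    then show ?thesis
      using n by auto
  qed
  show ?thesis
  proof (cases "angle s < \<theta>")
    case True
    have "s \<notin> path_image R"
    proof
      assume "s \<in> path_image R"
      then obtain x where "s = v + r * cis x" "\<alpha> + \<theta> \<le> x" "x \<le> \<alpha> + 2 * pi"
        using \<theta> by (auto simp: R_def path_image_part_circlepath cis_conv_exp)
      then show False
        using s_angle[of x] True \<theta> ne angle_bounds[of s] by auto
    qed
    then show ?thesis
      using winding_exit_point[OF R E avoid] sides(2) True by (simp add: s_def angle_def \<theta>_def)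
  next
    case False
    have "s \<notin> path_image L"
    proof
      assume "s \<in> path_image L"
      then obtain x where "s = v + r * cis x" "\<alpha> \<le> x" "x \<le> \<alpha> + \<theta>"
        using \<theta> by (auto simp: L_def path_image_part_circlepath cis_conv_exp simp del: reversepath_part_circlepath)
      then show False
        using s_angle[of x] False \<theta> ne angle_bounds[of s] by auto
    qed
    then show ?thesis
      using winding_exit_point[OF L E avoid] sides(1) False by (simp add: s_def angle_def \<theta>_def)
  qed
qed

end


section \<open>Winding numbers of cycles of a plane graph\<close>

lemma walk_avoids:
  assumes "walk G u ds w" "y \<notin> insert w (oedge_source G ` set ds)"
  shows "y \<notin> oedge_source G ` set ds \<union> oedge_target G ` set ds"
proof -
  have "oedge_target G ` set ds \<subseteq> insert w (oedge_source G ` set ds)"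
    unfolding walk_sources_targets[OF assms(1)] by (rule subset_insertI)
  then show ?thesis
    using assms(2) by blast
qed

section \<open>Reversal of cycles\<close>

lemma walk_reverse:
  "walk G u ds w \<Longrightarrow> walk G w (rev (map (apsnd Not) ds)) u"
  by (induction ds arbitrary: u) (auto simp: walk_append oedge_source_def oedge_target_def)

lemma oriented_cycle_reverse:
  assumes "oriented_cycle G D"
  shows "oriented_cycle G (apsnd Not ` D)"
proof -
  obtain d where "d \<in> D"
    using oriented_cycle_nonempty[OF assms] by blast
  then obtain ds where ds: "cycle_walk G (oedge_source G d) ds" "set ds = D"
    using cycle_walk_if_oriented_cycle[OF assms] by blast
  have "distinct (map (oedge_target G) ds)"
    using ds oriented_cycle_inj_target[OF assms] by (auto simp: cycle_walk_def distinct_map)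
  moreover have "oedge_source G \<circ> apsnd Not = oedge_target G" "fst \<circ> apsnd Not = fst"
    by (auto simp: fun_eq_iff oedge_source_def oedge_target_def)
  ultimately have "cycle_walk G (oedge_source G d) (rev (map (apsnd Not) ds))"
    using ds by (auto simp: cycle_walk_def walk_reverse simp flip: rev_map)
  from oriented_cycle_if_cycle_walk[OF this] show ?thesis
    using ds(2) by simp
qed

lemma chain_reverse: "chain (apsnd Not ` D) = - chain D"
proof -
  have "(e, b) \<in> apsnd Not ` D \<longleftrightarrow> (e, \<not> b) \<in> D" for e b
    by force
  then show ?thesis
    by (simp add: vec_eq_iff chain_nth)
qed

section \<open>Walks and cycles as curves\<close>

definition oedge_path :: "('e \<Rightarrow> real \<Rightarrow> complex) \<Rightarrow> 'e \<times> bool \<Rightarrow> real \<Rightarrow> complex" where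
  "oedge_path \<gamma> d = (if snd d then \<gamma> (fst d) else reversepath (\<gamma> (fst d)))"

text \<open>The empty list does not determine a vertex and has no path; a constant path is
  substituted where needed.\<close>

fun walk_path :: "('e \<Rightarrow> real \<Rightarrow> complex) \<Rightarrow> ('e \<times> bool) list \<Rightarrow> real \<Rightarrow> complex" where
  "walk_path \<gamma> [] = undefined"
| "walk_path \<gamma> [d] = oedge_path \<gamma> d"
| "walk_path \<gamma> (d # ds) = oedge_path \<gamma> d +++ walk_path \<gamma> ds"

definition curve :: "('e \<Rightarrow> real \<Rightarrow> complex) \<Rightarrow> 'e set \<Rightarrow> complex set" where
  "curve \<gamma> F = (\<Union>e\<in>F. path_image (\<gamma> e))"

text \<open>Summing over the set of oriented edges avoids choosing a starting vertex, so the cycle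
  can be cut open at any of its vertices. Off the curve the sum is the winding number of the closed
  curve.\<close>

definition cycle_winding :: "('e \<Rightarrow> real \<Rightarrow> complex) \<Rightarrow> ('e \<times> bool) set \<Rightarrow> complex \<Rightarrow> complex" where
  "cycle_winding \<gamma> D z = (\<Sum>d\<in>D. winding_number (oedge_path \<gamma> d) z)"

context plane_graph
begin

lemma oedge_path:
  assumes "fst d \<in> edges G"
  shows "arc (oedge_path \<gamma> d)" "path (oedge_path \<gamma> d)" "pathstart (oedge_path \<gamma> d) = oedge_source G d"
    "pathfinish (oedge_path \<gamma> d) = oedge_target G d" "path_image (oedge_path \<gamma> d) = path_image (\<gamma> (fst d))"
  using assms arc_edge pathstart_edge pathfinish_edge arc_imp_path
  by (auto simp: oedge_path_def oedge_source_def oedge_target_def arc_reversepath)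

lemma oedge_ends: "{oedge_source G d, oedge_target G d} = {tail G (fst d), head G (fst d)}"
  by (auto simp: oedge_source_def oedge_target_def)

lemma edge_Int_verts_oedge:
  "fst d \<in> edges G \<Longrightarrow> path_image (\<gamma> (fst d)) \<inter> verts G = {oedge_source G d, oedge_target G d}"
  using edge_Int_verts oedge_ends by metis

lemma edge_from:
  assumes "(u, x) \<in> darts"
  shows "arc (edge_from \<gamma> u x)" "path (edge_from \<gamma> u x)" "pathstart (edge_from \<gamma> u x) = u"
    "pathfinish (edge_from \<gamma> u x) = other_end G u x" "path_image (edge_from \<gamma> u x) = path_image (\<gamma> x)"
    "edge_from \<gamma> u x (1 / 2) = \<gamma> x (1 / 2)"
  using assms arc_edge pathstart_edge pathfinish_edge arc_imp_path no_loops
  by (auto simp: edge_from_def darts_iff other_end_def arc_reversepath) (auto simp: reversepath_def)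

lemma edge_from_source:
  assumes "fst d \<in> edges G"
  shows "edge_from \<gamma> (oedge_source G d) (fst d) = oedge_path \<gamma> d"
  using assms pathstart_edge no_loops
  by (auto simp: edge_from_def oedge_path_def oedge_source_def)

lemma edge_from_target:
  assumes "fst d \<in> edges G"
  shows "edge_from \<gamma> (oedge_target G d) (fst d) = reversepath (oedge_path \<gamma> d)"
  using assms pathstart_edge no_loops
  by (auto simp: edge_from_def oedge_path_def oedge_target_def)

lemma oedge_in_darts:
  "fst d \<in> edges G \<Longrightarrow> (oedge_source G d, fst d) \<in> darts"
  "fst d \<in> edges G \<Longrightarrow> (oedge_target G d, fst d) \<in> darts"
  by (auto simp: darts_iff oedge_source_def oedge_target_def)

lemma other_end_source: "fst d \<in> edges G \<Longrightarrow> other_end G (oedge_source G d) (fst d) = oedge_target G d"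
  and other_end_target: "fst d \<in> edges G \<Longrightarrow> other_end G (oedge_target G d) (fst d) = oedge_source G d"
  and source_neq_target: "fst d \<in> edges G \<Longrightarrow> oedge_source G d \<noteq> oedge_target G d"
  using no_loops[of "fst d"] by (auto simp: other_end_def oedge_source_def oedge_target_def)

lemma walk_path:
  assumes "walk G u ds w" "fst ` set ds \<subseteq> edges G" "ds \<noteq> []"
  shows "path (walk_path \<gamma> ds) \<and> pathstart (walk_path \<gamma> ds) = u \<and> pathfinish (walk_path \<gamma> ds) = w \<and>
    path_image (walk_path \<gamma> ds) = curve \<gamma> (fst ` set ds) \<and>
    (\<forall>z. z \<notin> curve \<gamma> (fst ` set ds) \<longrightarrow>
       winding_number (walk_path \<gamma> ds) z = (\<Sum>d\<leftarrow>ds. winding_number (oedge_path \<gamma> d) z))"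
  using assms
proof (induction ds arbitrary: u)
  case (Cons d ds)
  note d = oedge_path[of d]
  have "fst d \<in> edges G" using Cons.prems by simp
  show ?case
  proof (cases ds)
    case Nil
    then show ?thesis
      using Cons.prems d by (auto simp: curve_def)
  next
    case (Cons d' ds')
    then have ds: "walk G (oedge_target G d) ds w" "fst ` set ds \<subseteq> edges G" "ds \<noteq> []"
      "oedge_source G d = u" "walk_path \<gamma> (d # ds) = oedge_path \<gamma> d +++ walk_path \<gamma> ds"
      "curve \<gamma> (fst ` set (d # ds)) = path_image (\<gamma> (fst d)) \<union> curve \<gamma> (fst ` set ds)"
      using Cons.prems by (auto simp: curve_def)
    show ?thesis
      unfolding ds(5,6)
      using Cons.IH[OF ds(1-3)] d[OF \<open>fst d \<in> edges G\<close>] ds(4)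
      by (simp add: path_image_join winding_number_join)
  qed
qed simp

lemma curve_Int_verts:
  assumes "fst ` D \<subseteq> edges G"
  shows "curve \<gamma> (fst ` D) \<inter> verts G = oedge_source G ` D \<union> oedge_target G ` D"
proof -
  have "curve \<gamma> (fst ` D) \<inter> verts G = (\<Union>d\<in>D. path_image (\<gamma> (fst d)) \<inter> verts G)"
    by (auto simp: curve_def)
  also have "\<dots> = (\<Union>d\<in>D. {oedge_source G d, oedge_target G d})"
    using assms edge_Int_verts_oedge by (intro SUP_cong) auto
  finally show ?thesis by auto
qed

lemma edge_Int_curve:
  assumes "e \<in> edges G" "F \<subseteq> edges G" "e \<notin> F"
  shows "path_image (\<gamma> e) \<inter> curve \<gamma> F \<subseteq> {tail G e, head G e}"
proof -
  have "path_image (\<gamma> e) \<inter> curve \<gamma> F \<subseteq> verts G"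
    using assms edge_Int_edge by (fastforce simp: curve_def)
  then show ?thesis
    using edge_Int_verts[OF assms(1)] by blast
qed

lemma arc_walk_path:
  assumes "walk G u ds w" "fst ` set ds \<subseteq> edges G" "ds \<noteq> []"
    and "distinct (map fst ds)" "distinct (map (oedge_source G) ds)" "w \<notin> oedge_source G ` set ds"
  shows "arc (walk_path \<gamma> ds)"
  using assms
proof (induction ds arbitrary: u)
  case (Cons d ds)
  note d = oedge_path[of d]
  have "fst d \<in> edges G" using Cons.prems by simp
  show ?case
  proof (cases ds)
    case Nil
    then show ?thesis using Cons.prems d by auto
  next
    case (Cons d' ds')
    then have ds: "walk G (oedge_target G d) ds w" "fst ` set ds \<subseteq> edges G" "ds \<noteq> []"
      "walk_path \<gamma> (d # ds) = oedge_path \<gamma> d +++ walk_path \<gamma> ds"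
      using Cons.prems by auto
    note wp = walk_path[OF ds(1-3)]
    show ?thesis
      unfolding ds(4)
    proof (rule arc_join)
      show "arc (walk_path \<gamma> ds)"
        using Cons.IH[OF ds(1-3)] Cons.prems by simp
      show "path_image (oedge_path \<gamma> d) \<inter> path_image (walk_path \<gamma> ds) \<subseteq> {pathstart (walk_path \<gamma> ds)}"
      proof
        fix x assume x: "x \<in> path_image (oedge_path \<gamma> d) \<inter> path_image (walk_path \<gamma> ds)"
        have "path_image (\<gamma> (fst d)) \<inter> curve \<gamma> (fst ` set ds) \<subseteq> {oedge_source G d, oedge_target G d}"
          unfolding oedge_ends
          using Cons.prems ds(2) \<open>fst d \<in> edges G\<close> by (intro edge_Int_curve) auto
        then have x_end: "x = oedge_source G d \<or> x = oedge_target G d"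
          using x wp d[OF \<open>fst d \<in> edges G\<close>] by auto
        have "oedge_source G d \<notin> oedge_source G ` set ds \<union> oedge_target G ` set ds"
          using Cons.prems by (intro walk_avoids[OF ds(1)]) auto
        moreover have "oedge_source G d \<in> verts G"
          using \<open>fst d \<in> edges G\<close> tail_in_verts head_in_verts by (auto simp: oedge_source_def)
        ultimately have "oedge_source G d \<notin> curve \<gamma> (fst ` set ds)"
          using curve_Int_verts[OF ds(2)] by blast
        then show "x \<in> {pathstart (walk_path \<gamma> ds)}"
          using x x_end wp by auto
      qed
    qed (use wp d \<open>fst d \<in> edges G\<close> in auto)
  qed
qed simp

text \<open>Without its first edge the cycle is an arc, and it is nonempty as there are no loops.
  This arc and the first edge meet only in their common ends.\<close>

lemma cycle_loop:
  assumes D: "oriented_cycle G D"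
  obtains \<Gamma> where "simple_path \<Gamma>" "pathfinish \<Gamma> = pathstart \<Gamma>" "path_image \<Gamma> = curve \<gamma> (fst ` D)"
    "\<And>z. z \<notin> curve \<gamma> (fst ` D) \<Longrightarrow> winding_number \<Gamma> z = cycle_winding \<gamma> D z"
proof -
  obtain d0 where "d0 \<in> D"
    using oriented_cycle_nonempty[OF D] by blast
  then obtain ds' where ds': "cycle_walk G (oedge_source G d0) ds'" "set ds' = D"
    using cycle_walk_if_oriented_cycle[OF D] by blast
  then obtain d ds where dds: "ds' = d # ds"
    by (auto simp: cycle_walk_def neq_Nil_conv)
  have d_edge: "fst d \<in> edges G" and ds: "fst ` set ds \<subseteq> edges G" "walk G (oedge_target G d) ds (oedge_source G d)"
    "distinct (map fst ds)" "distinct (map (oedge_source G) ds)" "oedge_source G d \<notin> oedge_source G ` set ds"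
    "fst d \<notin> fst ` set ds" "distinct (d # ds)"
    using ds' dds by (auto simp: cycle_walk_def distinct_map)
  have "ds \<noteq> []"
    using ds(2) source_neq_target[OF d_edge] by auto
  note d = oedge_path[OF d_edge]
  note wp = walk_path[OF ds(2,1) \<open>ds \<noteq> []\<close>]
  have curve_D: "curve \<gamma> (fst ` D) = path_image (\<gamma> (fst d)) \<union> curve \<gamma> (fst ` set ds)"
    using ds'(2) dds by (auto simp: curve_def)
  show ?thesis
  proof (rule that[of "oedge_path \<gamma> d +++ walk_path \<gamma> ds"])
    show "simple_path (oedge_path \<gamma> d +++ walk_path \<gamma> ds)"
      using arc_walk_path[OF ds(2,1) \<open>ds \<noteq> []\<close> ds(3-5)] d wp edge_Int_curve[OF d_edge ds(1,6)]
      by (intro simple_path_join_loop) (auto simp flip: oedge_ends)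
    fix z assume z: "z \<notin> curve \<gamma> (fst ` D)"
    have "cycle_winding \<gamma> D z = (\<Sum>d\<leftarrow>d # ds. winding_number (oedge_path \<gamma> d) z)"
      unfolding cycle_winding_def ds'(2)[symmetric] dds using ds(7) by (simp add: sum_list_distinct_conv_sum_set)
    then show "winding_number (oedge_path \<gamma> d +++ walk_path \<gamma> ds) z = cycle_winding \<gamma> D z"
      using z d wp by (simp add: curve_D winding_number_join)
  qed (use d wp curve_D in \<open>auto simp: path_image_join\<close>)
qed

lemma cycle_winding_eq_if_connected:
  assumes "oriented_cycle G D" "connected S" "S \<inter> curve \<gamma> (fst ` D) = {}" "x \<in> S" "y \<in> S"
  shows "cycle_winding \<gamma> D x = cycle_winding \<gamma> D y"
proof -
  obtain \<Gamma> where \<Gamma>: "simple_path \<Gamma>" "pathfinish \<Gamma> = pathstart \<Gamma>" "path_image \<Gamma> = curve \<gamma> (fst ` D)"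
    "\<And>z. z \<notin> curve \<gamma> (fst ` D) \<Longrightarrow> winding_number \<Gamma> z = cycle_winding \<gamma> D z"
    using cycle_loop[OF assms(1)] by blast
  have "winding_number \<Gamma> x = winding_number \<Gamma> y"
    using assms \<Gamma> by (intro winding_number_eq[of _ _ S]) (auto simp: simple_path_imp_path)
  moreover have "x \<notin> curve \<gamma> (fst ` D)" "y \<notin> curve \<gamma> (fst ` D)"
    using assms by auto
  ultimately show ?thesis
    using \<Gamma>(4) by simp
qed

text \<open>The Jordan curve theorem; \<open>\<epsilon>\<close> records whether the cycle runs
  counter-clockwise or clockwise.\<close>

lemma cycle_winding_values:
  assumes "oriented_cycle G D"
  obtains \<epsilon> :: real where "\<epsilon> \<in> {1, - 1}"
    "\<And>z. z \<notin> curve \<gamma> (fst ` D) \<Longrightarrow> cycle_winding \<gamma> D z \<in> {0, of_real \<epsilon>}"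
proof -
  obtain \<Gamma> where \<Gamma>: "simple_path \<Gamma>" "pathfinish \<Gamma> = pathstart \<Gamma>" "path_image \<Gamma> = curve \<gamma> (fst ` D)"
    "\<And>z. z \<notin> curve \<gamma> (fst ` D) \<Longrightarrow> winding_number \<Gamma> z = cycle_winding \<gamma> D z"
    using cycle_loop[OF assms] by blast
  obtain \<epsilon> :: real where \<epsilon>: "\<epsilon> \<in> {1, - 1}" "\<And>z. z \<in> inside (path_image \<Gamma>) \<Longrightarrow> winding_number \<Gamma> z = of_real \<epsilon>"
    using simple_closed_path_winding_number_inside[OF \<Gamma>(1)]
    by (metis insertCI of_real_1 of_real_minus)
  show ?thesis
  proof (rule that[OF \<epsilon>(1)])
    fix z assume z: "z \<notin> curve \<gamma> (fst ` D)"
    then consider "z \<in> inside (path_image \<Gamma>)" | "z \<in> outside (path_image \<Gamma>)"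
      using inside_Un_outside[of "path_image \<Gamma>"] \<Gamma>(3) by blast
    then show "cycle_winding \<gamma> D z \<in> {0, of_real \<epsilon>}"
      using \<epsilon>(2) \<Gamma>(4)[OF z] winding_number_zero_in_outside[OF simple_path_imp_path[OF \<Gamma>(1)] \<Gamma>(2)]
      by cases auto
  qed
qed

lemma edge_from_interior:
  assumes "(u, x) \<in> darts" "0 < t" "t < 1" "D \<subseteq> edges G" "x \<notin> D"
  shows "edge_from \<gamma> u x t \<notin> curve \<gamma> D"
proof
  note e = edge_from[OF assms(1)]
  have xG: "x \<in> edges G" and ends: "{tail G x, head G x} = {u, other_end G u x}"
    using assms(1) by (auto simp: darts_iff other_end_def)
  assume "edge_from \<gamma> u x t \<in> curve \<gamma> D"
  moreover have "edge_from \<gamma> u x t \<in> path_image (\<gamma> x)"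
    unfolding e(5)[symmetric] using assms by (auto simp: path_image_def)
  ultimately have "edge_from \<gamma> u x t \<in> {edge_from \<gamma> u x 0, edge_from \<gamma> u x 1}"
    using edge_Int_curve[OF xG assms(4,5)] e(3,4) ends by (auto simp: pathstart_def pathfinish_def)
  then show False
    using inj_onD[of "edge_from \<gamma> u x" "{0..1}" t 0] inj_onD[of "edge_from \<gamma> u x" "{0..1}" t 1]
      e(1) assms(2,3) by (auto simp: arc_def)
qed

text \<open>The point at parameter 1/2 is the same from both ends of \<open>x\<close>, so it serves
  as a common reference when the ends are compared.\<close>

lemma cycle_winding_edge:
  assumes D: "oriented_cycle G D" and ux: "(u, x) \<in> darts" "x \<notin> fst ` D"
  shows "0 < t \<Longrightarrow> t < 1 \<Longrightarrow> cycle_winding \<gamma> D (edge_from \<gamma> u x t) = cycle_winding \<gamma> D (\<gamma> x (1 / 2))"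
    and "u \<notin> curve \<gamma> (fst ` D) \<Longrightarrow> cycle_winding \<gamma> D u = cycle_winding \<gamma> D (\<gamma> x (1 / 2))"
proof -
  let ?E = "edge_from \<gamma> u x"
  note E = edge_from[OF ux(1)]
  have cont: "continuous_on {0..1} ?E"
    using E(2) by (simp add: path_def)
  have interior: "?E t \<notin> curve \<gamma> (fst ` D)" if "0 < t" "t < 1" for t
    using edge_from_interior[OF ux(1) that oriented_cycle_edges[OF D] ux(2)] .
  show "cycle_winding \<gamma> D (?E t) = cycle_winding \<gamma> D (\<gamma> x (1 / 2))" if "0 < t" "t < 1"
  proof (rule cycle_winding_eq_if_connected[OF D])
    show "connected (?E ` {0<..<1})"
      by (intro connected_continuous_image continuous_on_subset[OF cont]) auto
  qed (use interior that in \<open>auto simp flip: E(6)\<close>)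
  show "cycle_winding \<gamma> D u = cycle_winding \<gamma> D (\<gamma> x (1 / 2))" if "u \<notin> curve \<gamma> (fst ` D)"
  proof (rule cycle_winding_eq_if_connected[OF D])
    have E0: "?E 0 = u"
      using E(3) by (simp add: pathstart_def)
    show "connected (?E ` {0..<1})"
      by (intro connected_continuous_image continuous_on_subset[OF cont]) auto
    have "?E t \<notin> curve \<gamma> (fst ` D)" if "0 \<le> t" "t < 1" for t
      using that interior[of t] \<open>u \<notin> curve \<gamma> (fst ` D)\<close> E0 by (cases "t = 0") auto
    then show "?E ` {0..<1} \<inter> curve \<gamma> (fst ` D) = {}"
      by auto
    show "u \<in> ?E ` {0..<1}"
      using E0 by force
  qed (simp flip: E(6))
qed

lemma exit_point_eq: "exit_point \<gamma> r u x = edge_from \<gamma> u x (exit_time (edge_from \<gamma> u x) u r)"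
  by (simp add: exit_point_def exit_time_def)

lemma dist_pathfinish_edge_from:
  assumes "(u, x) \<in> darts" and "\<And>u w. u \<in> verts G \<Longrightarrow> w \<in> verts G \<Longrightarrow> u \<noteq> w \<Longrightarrow> r < dist u w"
  shows "r < dist u (pathfinish (edge_from \<gamma> u x))"
  unfolding edge_from(4)[OF assms(1)]
  using assms(1) no_loops tail_in_verts head_in_verts by (intro assms(2)) (auto simp: darts_iff other_end_def)

lemma cycle_winding_exit_point:
  assumes D: "oriented_cycle G D" and r: "0 < r"
      "\<And>u w. u \<in> verts G \<Longrightarrow> w \<in> verts G \<Longrightarrow> u \<noteq> w \<Longrightarrow> r < dist u w"
    and eps: "\<epsilon> \<in> {1, - 1}" "\<And>z. z \<notin> curve \<gamma> (fst ` D) \<Longrightarrow> cycle_winding \<gamma> D z \<in> {0, of_real \<epsilon>}"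
    and gf: "g \<in> D" "f \<in> D" "oedge_source G g = u" "oedge_target G f = u"
    and ux: "(u, x) \<in> darts" "x \<notin> fst ` D"
  shows "cycle_winding \<gamma> D (exit_point \<gamma> r u x) =
    of_real (if ccw_angle \<gamma> r u (fst g) x < ccw_angle \<gamma> r u (fst g) (fst f) then (\<epsilon> + 1) / 2 else (\<epsilon> - 1) / 2)"
proof -
  obtain ds where ds: "cycle_walk G u ds" "set ds = D"
    using cycle_walk_if_oriented_cycle[OF D, of u] gf by blast
  have edges: "fst ` D \<subseteq> edges G" and gE: "fst g \<in> edges G" and fE: "fst f \<in> edges G"
    using oriented_cycle_edges[OF D] gf by auto
  have "g \<noteq> f"
    using gf source_neq_target[OF gE] by auto
  obtain ds' where ds': "ds = g # ds'"
  proof (cases ds)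
    case (Cons d ds'')
    then have "oedge_source G d = u" "d \<in> D"
      using ds by (auto simp: cycle_walk_def)
    then have "d = g"
      using inj_onD[OF oriented_cycle_inj_source[OF D]] gf by metis
    then show ?thesis using Cons that by simp
  qed (use ds in \<open>simp add: cycle_walk_def\<close>)
  have "ds' \<noteq> []"
    using ds ds' gf \<open>g \<noteq> f\<close> by auto
  then obtain mid d where mid: "ds' = mid @ [d]"
    by (metis append_butlast_last_id)
  have "oedge_target G d = u" "d \<in> D"
    using ds by (auto simp: cycle_walk_def ds' mid walk_append)
  then have "d = f"
    using inj_onD[OF oriented_cycle_inj_target[OF D]] gf by metis
  with mid ds ds' have walk_mid: "walk G (oedge_target G g) mid (oedge_source G f)"
    and dist: "distinct (g # mid @ [f])" "distinct (map fst (g # mid @ [f]))"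
      "distinct (map (oedge_source G) (g # mid @ [f]))"
    and set_D: "D = set (g # mid @ [f])"
    by (auto simp: cycle_walk_def walk_append distinct_map)
  \<comment> \<open>For two parallel edges nothing lies between \<open>g\<close> and
    \<open>f\<close>; a constant path at their common far end then contributes winding number
    0.\<close>
  define N where "N = (if mid = [] then linepath (oedge_target G g) (oedge_target G g) else walk_path \<gamma> mid)"
  have mid_edges: "fst ` set mid \<subseteq> edges G"
    using edges set_D by auto
  have N_path: "path N" "pathstart N = oedge_target G g" "pathfinish N = oedge_source G f"
    "path_image N \<subseteq> insert (oedge_target G g) (curve \<gamma> (fst ` set mid))"
    "curve \<gamma> (fst ` set mid) \<subseteq> path_image N"
    "\<And>z. z \<notin> path_image N \<Longrightarrow> winding_number N z = (\<Sum>d\<leftarrow>mid. winding_number (oedge_path \<gamma> d) z)"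
    using walk_path[OF walk_mid mid_edges] walk_mid by (auto simp: N_def curve_def)
  have u_vert: "u \<in> verts G"
    using ux by (auto simp: darts_def)
  have "u \<notin> oedge_source G ` set mid \<union> oedge_target G ` set mid"
    using dist(3) gf source_neq_target[OF fE] by (intro walk_avoids[OF walk_mid]) auto
  then have "u \<notin> curve \<gamma> (fst ` set mid)"
    using curve_Int_verts[OF mid_edges] u_vert by blast
  then have u_N: "u \<notin> path_image N"
    using N_path(4) gf source_neq_target[OF gE] by auto
  let ?G = "edge_from \<gamma> u (fst g)" and ?F = "edge_from \<gamma> u (fst f)" and ?E = "edge_from \<gamma> u x"
  have darts_gf: "(u, fst g) \<in> darts" "(u, fst f) \<in> darts"
    using oedge_in_darts(1)[OF gE] oedge_in_darts(2)[OF fE] gf by auto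
  note G = edge_from[OF darts_gf(1)] and F = edge_from[OF darts_gf(2)] and E = edge_from[OF ux(1)]
  have ends: "pathfinish ?G = oedge_target G g" "pathfinish ?F = oedge_source G f"
    using G(4) F(4) other_end_source[OF gE] other_end_target[OF fE] gf by auto
  have dists: "r < dist u (pathfinish ?G)" "r < dist u (pathfinish ?F)" "r < dist u (pathfinish ?E)"
    using dist_pathfinish_edge_from r(2) darts_gf ux(1) by blast+
  interpret loop_at ?G ?F N u r
  proof
    have "path_image (\<gamma> (fst g)) \<inter> curve \<gamma> {fst f} \<subseteq> {tail G (fst g), head G (fst g)}"
      using gE fE dist(2) by (intro edge_Int_curve) auto
    also have "\<dots> = {u, pathfinish ?G}"
      using ends gf by (auto simp flip: oedge_ends)
    finally show "path_image ?G \<inter> path_image ?F \<subseteq> {u, pathfinish ?G}"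
      using G(5) F(5) by (simp add: curve_def)
  qed (use G F N_path ends u_N r dists in auto)
  have image: "loop_image = curve \<gamma> (fst ` D)"
  proof -
    have "oedge_target G g \<in> path_image (\<gamma> (fst g))"
      using edge_Int_verts_oedge[OF gE] by blast
    then show ?thesis
      using N_path(4,5) G(5) F(5) by (auto simp: loop_image_def set_D curve_def)
  qed
  have winding: "winding z = cycle_winding \<gamma> D z" if "z \<notin> loop_image" for z
  proof -
    have "z \<notin> path_image (oedge_path \<gamma> f)"
      using that oedge_path[OF fE] F(5) by (simp add: loop_image_def)
    then have "winding_number ?F z = - winding_number (oedge_path \<gamma> f) z"
      using edge_from_target[OF fE] gf oedge_path[OF fE] by (simp add: winding_number_reversepath)
    moreover have "cycle_winding \<gamma> D z = (\<Sum>d\<leftarrow>g # mid @ [f]. winding_number (oedge_path \<gamma> d) z)"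
      unfolding cycle_winding_def set_D using dist(1) by (metis sum_list_distinct_conv_sum_set)
    ultimately show ?thesis
      using N_path(6)[of z] that edge_from_source[OF gE] gf unfolding winding_def loop_image_def by simp
  qed
  have exit: "0 < exit_time ?E u r" "exit_time ?E u r < 1"
    using exit_time(1)[OF E(2,3) r(1)] exit_time_less_1[OF E(2,3) r(1)] dists by auto
  have avoid: "?E t \<notin> loop_image" if "0 < t" "t \<le> exit_time ?E u r" for t
    using edge_from_interior[OF ux(1) that(1) _ edges ux(2)] that exit unfolding image by auto
  have "cycle_winding \<gamma> D (exit_point \<gamma> r u x) = winding (exit_point \<gamma> r u x)"
    using winding avoid[OF exit(1)] by (simp add: exit_point_eq)
  also have "\<dots> = (if ccw_angle \<gamma> r u (fst g) x < ccw_angle \<gamma> r u (fst g) (fst f)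
      then (complex_of_real \<epsilon> + 1) / 2 else (complex_of_real \<epsilon> - 1) / 2)"
    unfolding exit_point_eq ccw_angle_def G_exit_def[symmetric] F_exit_def[symmetric]
    using dists eps winding image avoid
    by (intro winding_side) (auto simp: E)
  finally show ?thesis by simp
qed

end


section \<open>Dual potentials of cycles of a plane graph\<close>

locale plane_ribbon_graph = plane_graph G \<gamma>
  for G :: "(complex, 'e::finite) multigraph" and \<gamma> +
  fixes \<rho> :: "complex \<Rightarrow> 'e \<Rightarrow> 'e"
  assumes induced: "induced_ribbon_structure G \<gamma> \<rho>"
begin

sublocale ribbon_graph G \<rho>
  using induced by unfold_locales (simp add: induced_ribbon_structure_def)

text \<open>There are finitely many darts and vertices, so one radius suits them all. It is below
  the distance between vertices, so every edge does leave the disc.\<close>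

lemma small_radius:
  obtains r where "0 < r" "\<And>u w. u \<in> verts G \<Longrightarrow> w \<in> verts G \<Longrightarrow> u \<noteq> w \<Longrightarrow> r < dist u w"
    "\<And>u x. (u, x) \<in> darts \<Longrightarrow> ccw_next G \<gamma> r u x (\<rho> u x)"
proof -
  have "\<forall>\<^sub>F r in at_right 0. \<forall>(u, x)\<in>darts. ccw_next G \<gamma> r u x (\<rho> u x)"
    using induced finite_darts
    by (intro eventually_ball_finite) (auto simp: induced_ribbon_structure_def darts_def)
  moreover have "\<forall>\<^sub>F r in at_right 0. r < dist u w" if "u \<noteq> w" for u w :: complex
    using that by (auto simp: eventually_at_right_field intro!: exI[of _ "dist u w"])
  then have "\<forall>\<^sub>F r in at_right 0. \<forall>u\<in>verts G. \<forall>w\<in>verts G. u \<noteq> w \<longrightarrow> r < dist u w"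
    using finite_verts by (intro eventually_ball_finite ballI) auto
  moreover have "\<forall>\<^sub>F r in at_right 0. (0::real) < r"
    by (simp add: eventually_at_right_less)
  ultimately have "\<forall>\<^sub>F r in at_right 0. (\<forall>(u, x)\<in>darts. ccw_next G \<gamma> r u x (\<rho> u x)) \<and>
      (\<forall>u\<in>verts G. \<forall>w\<in>verts G. u \<noteq> w \<longrightarrow> r < dist u w) \<and> 0 < r"
    by eventually_elim blast
  then have "\<exists>r. (\<forall>(u, x)\<in>darts. ccw_next G \<gamma> r u x (\<rho> u x)) \<and>
      (\<forall>u\<in>verts G. \<forall>w\<in>verts G. u \<noteq> w \<longrightarrow> r < dist u w) \<and> 0 < r"
    by (rule eventually_happens'[OF trivial_limit_at_right_real[unfolded trivial_limit_def[symmetric]]])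
  then show ?thesis
    using that by blast
qed

end

locale small_disc = plane_ribbon_graph G \<gamma> \<rho>
  for G :: "(complex, 'e::finite) multigraph" and \<gamma> \<rho> +
  fixes r :: real
  assumes r: "0 < r" "\<And>u w. u \<in> verts G \<Longrightarrow> w \<in> verts G \<Longrightarrow> u \<noteq> w \<Longrightarrow> r < dist u w"
    and next_edge: "\<And>u x. (u, x) \<in> darts \<Longrightarrow> ccw_next G \<gamma> r u x (\<rho> u x)"
begin

section \<open>Cyclic order of the exit points\<close>

abbreviation angle :: "complex \<Rightarrow> 'e \<Rightarrow> 'e \<Rightarrow> real" where
  "angle \<equiv> ccw_angle \<gamma> r"

lemma exit_point:
  assumes "(u, x) \<in> darts"
  shows "exit_point \<gamma> r u x \<in> sphere u r" "exit_point \<gamma> r u x \<in> path_image (\<gamma> x)"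
proof -
  note e = edge_from[OF assms]
  have "r \<le> dist u (pathfinish (edge_from \<gamma> u x))"
    using dist_pathfinish_edge_from[OF assms r(2)] by simp
  from exit_time[OF e(2,3) r(1) this]
  show "exit_point \<gamma> r u x \<in> sphere u r" "exit_point \<gamma> r u x \<in> path_image (\<gamma> x)"
    unfolding exit_point_eq e(5)[symmetric] by (auto simp: path_image_def)
qed

text \<open>Distinct edges share only vertices, and no vertex lies on the circle.\<close>

lemma exit_point_inj:
  assumes "(u, x) \<in> darts" "(u, y) \<in> darts" "exit_point \<gamma> r u x = exit_point \<gamma> r u y"
  shows "x = y"
proof (rule ccontr)
  assume "x \<noteq> y"
  then have "exit_point \<gamma> r u x \<in> verts G"
    using edge_Int_edge[of x y] exit_point[OF assms(1)] exit_point[OF assms(2)] assms by (auto simp: darts_iff)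
  moreover have "u \<in> verts G"
    using assms by (simp add: darts_def)
  ultimately show False
    using exit_point(1)[OF assms(1)] r by fastforce
qed

lemma angle_bounds: "0 \<le> angle u x y" "angle u x y < 2 * pi"
  by (auto simp: ccw_angle_def Arg2pi_ge_0 Arg2pi_lt_2pi)

lemma exit_point_neq: "(u, x) \<in> darts \<Longrightarrow> exit_point \<gamma> r u x - u \<noteq> 0"
  using exit_point(1)[of u x] r(1) by auto

lemma angle_self: "(u, g) \<in> darts \<Longrightarrow> angle u g g = 0"
  using exit_point_neq[of u g] Arg2pi_of_real[of 1] by (simp add: ccw_angle_def)

lemma angle_diff:
  assumes "(u, g) \<in> darts" "(u, x) \<in> darts" "(u, y) \<in> darts"
  shows "angle u x y = angle u g y - angle u g x + (if angle u g x \<le> angle u g y then 0 else 2 * pi)"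
  using Arg2pi_diff[of "(exit_point \<gamma> r u y - u) / (exit_point \<gamma> r u g - u)"
      "(exit_point \<gamma> r u x - u) / (exit_point \<gamma> r u g - u)"]
    exit_point_neq[OF assms(1)] exit_point_neq[OF assms(2)] exit_point_neq[OF assms(3)]
  by (auto simp: ccw_angle_def)

lemma angle_inj:
  assumes "(u, g) \<in> darts" "(u, x) \<in> darts" "(u, y) \<in> darts" "angle u g x = angle u g y"
  shows "x = y"
proof -
  let ?e = "\<lambda>x. exit_point \<gamma> r u x - u"
  have norms: "norm (?e x) = r" "norm (?e y) = r"
    using exit_point(1)[OF assms(2)] exit_point(1)[OF assms(3)] by (auto simp: dist_norm norm_minus_commute)
  obtain c where c: "0 < c" "?e x / ?e g = of_real c * (?e y / ?e g)"
    using assms(4) exit_point_neq assms(1-3) by (auto simp: ccw_angle_def Arg2pi_eq_iff)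
  then have "?e x = of_real c * ?e y"
    using exit_point_neq[OF assms(1)] by (simp add: field_simps)
  moreover from this have "c = 1"
    using norms r(1) c(1) by (metis abs_of_pos mult_cancel_right2 norm_mult norm_of_real order_less_irrefl)
  ultimately have "exit_point \<gamma> r u x = exit_point \<gamma> r u y"
    by simp
  then show ?thesis
    using exit_point_inj assms by blast
qed

text \<open>
  The corner at \<open>u\<close> between the predecessor of \<open>x\<close> and \<open>x\<close> lies to the left of a path that enters
  \<open>u\<close> along \<open>f\<close> and leaves along \<open>g\<close>.
\<close>

definition left_corner :: "complex \<Rightarrow> 'e \<Rightarrow> 'e \<Rightarrow> 'e \<Rightarrow> bool" where
  "left_corner u g f x \<longleftrightarrow> x \<noteq> g \<and> angle u g x \<le> angle u g f"

text \<open>Turning counter-clockwise, one enters the left sector by passing \<open>g\<close> and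
  leaves it by passing \<open>f\<close>. The corner before \<open>f\<close> is still on the left and
  the corner before \<open>g\<close> on the right.\<close>

lemma left_corner_rho:
  assumes g: "(u, g) \<in> darts" and f: "(u, f) \<in> darts" and x: "(u, x) \<in> darts" and "g \<noteq> f"
  shows "left_corner u g f (\<rho> u x) \<longleftrightarrow> x = g \<or> x \<noteq> f \<and> left_corner u g f x"
proof -
  let ?a = "angle u g"
  define n where "n = \<rho> u x"
  have n: "(u, n) \<in> darts"
    using rho_in_darts[OF x] by (simp add: n_def)
  have next_x: "ccw_next G \<gamma> r u x n"
    using next_edge[OF x] by (simp add: n_def)
  \<comment> \<open>At least the two edges \<open>g\<close> and \<open>f\<close> meet at
    \<open>u\<close>, so \<open>x\<close> is not its own successor.\<close>
  have "n \<noteq> x"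
    using next_x g f \<open>g \<noteq> f\<close> by (auto simp: ccw_next_def darts_def)
  have le: "angle u x n \<le> angle u x y" if "(u, y) \<in> darts" "y \<noteq> x" for y
    using next_x that by (auto simp: ccw_next_def darts_def)
  have pos: "0 < ?a y" if "(u, y) \<in> darts" "y \<noteq> g" for y
    using angle_inj[OF g that(1) g] angle_self[OF g] angle_bounds(1)[of u g y] that(2) by force
  have eq: "?a y = ?a z \<longleftrightarrow> y = z" if "(u, y) \<in> darts" "(u, z) \<in> darts" for y z
    using angle_inj[OF g that] by blast
  note diff = angle_diff[OF g x]
  consider "x = g" | "x = f" "x \<noteq> g" | "x \<noteq> g" "x \<noteq> f" by blast
  then have "left_corner u g f n \<longleftrightarrow> x = g \<or> x \<noteq> f \<and> left_corner u g f x"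
  proof cases
    case 1
    then show ?thesis
      using le[OF f] \<open>n \<noteq> x\<close> \<open>g \<noteq> f\<close> by (auto simp: left_corner_def)
  next
    case 2
    \<comment> \<open>Counter-clockwise from \<open>f\<close>, an edge of smaller angle comes only
      after \<open>g\<close>, contrary to the minimality of \<open>n\<close>.\<close>
    have "\<not> ?a n \<le> ?a f" if "n \<noteq> g"
    proof
      assume "?a n \<le> ?a f"
      then have "?a n < ?a f"
        using eq[OF n f] \<open>n \<noteq> x\<close> 2 by force
      then have "?a n - ?a f + 2 * pi \<le> 2 * pi - ?a f"
        using le[OF g] 2 diff[OF n] diff[OF g] angle_self[OF g] pos[OF f] by auto
      then show False
        using pos[OF n that] by simp
    qed
    then show ?thesis
      using 2 by (auto simp: left_corner_def)
  next
    case 3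
    show ?thesis
    proof (cases "?a x \<le> ?a f")
      case True
      then have "angle u x n \<le> ?a f - ?a x"
        using le[OF f] diff[OF f] 3 by auto
      then have "n \<noteq> g \<and> ?a n \<le> ?a f"
        using diff[OF n] pos[OF x 3(1)] angle_self[OF g] angle_bounds(2)[of u g f] angle_bounds(1)[of u g n]
        by (auto split: if_splits)
      then show ?thesis
        using True 3 by (auto simp: left_corner_def)
    next
      case False
      \<comment> \<open>Beyond \<open>f\<close>, the next edge is \<open>g\<close> at the latest, so
        \<open>n\<close> cannot wrap around into the left sector.\<close>
      have "angle u x n \<le> 2 * pi - ?a x"
        using le[OF g] diff[OF g] 3 angle_self[OF g] pos[OF x 3(1)] by auto
      then have "\<not> ?a n \<le> ?a f" if "n \<noteq> g"
        using diff[OF n] pos[OF n that] False by (auto split: if_splits)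
      then show ?thesis
        using False 3 by (auto simp: left_corner_def)
    qed
  qed
  then show ?thesis
    by (simp add: n_def)
qed

text \<open>The jump condition follows from the cyclic order at vertices of the cycle. For edges
  outside the cycle, the condition on the two ends follows from winding numbers, since these also
  express \<open>k\<close> at the vertices of the cycle.\<close>

lemma ex_dual_potential:
  assumes D: "oriented_cycle G D"
  shows "\<exists>k. dual_potential (chain D) k \<and> (\<forall>(u, x)\<in>darts. k u x \<in> {0, 1})"
proof -
  obtain \<epsilon> :: real where \<epsilon>: "\<epsilon> \<in> {1, - 1}"
    "\<And>z. z \<notin> curve \<gamma> (fst ` D) \<Longrightarrow> cycle_winding \<gamma> D z \<in> {0, of_real \<epsilon>}"
    using cycle_winding_values[OF D] by metis
  \<comment> \<open>The winding number on the left: 1 for a counter-clockwise cycle, 0 for a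
    clockwise one. Subtracting the winding number from \<open>L\<close> gives 0 on the left and 1 on
    the right.\<close>
  define L where "L = (\<epsilon> + 1) / 2"
  define V where "V = oedge_source G ` D"
  have V_targets: "V = oedge_target G ` D"
    using oriented_cycle_sources_eq_targets[OF D] by (simp add: V_def)
  have edges: "fst ` D \<subseteq> edges G"
    using oriented_cycle_edges[OF D] .
  have curve_verts: "u \<in> curve \<gamma> (fst ` D) \<longleftrightarrow> u \<in> V" if "u \<in> verts G" for u
    using curve_Int_verts[OF edges] that V_def V_targets by blast
  have "\<exists>g. g \<in> D \<and> oedge_source G g = u" if "u \<in> V" for u
    using that by (auto simp: V_def)
  then obtain out where out: "\<And>u. u \<in> V \<Longrightarrow> out u \<in> D" "\<And>u. u \<in> V \<Longrightarrow> oedge_source G (out u) = u"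
    by metis
  have "\<exists>f. f \<in> D \<and> oedge_target G f = u" if "u \<in> V" for u
    using that by (auto simp: V_targets)
  then obtain inc where inc: "\<And>u. u \<in> V \<Longrightarrow> inc u \<in> D" "\<And>u. u \<in> V \<Longrightarrow> oedge_target G (inc u) = u"
    by metis
  have at_source: "oedge_source G d \<in> V" "out (oedge_source G d) = d" if "d \<in> D" for d
    using that out inj_onD[OF oriented_cycle_inj_source[OF D]] by (auto simp: V_def)
  have at_target: "oedge_target G d \<in> V" "inc (oedge_target G d) = d" if "d \<in> D" for d
    using that inc inj_onD[OF oriented_cycle_inj_target[OF D]] by (auto simp: V_targets)
  define g f where "g u = fst (out u)" and "f u = fst (inc u)" for u
  have gf: "(u, g u) \<in> darts" "(u, f u) \<in> darts" "g u \<noteq> f u" "g u \<in> fst ` D" "f u \<in> fst ` D" if "u \<in> V" for u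
  proof -
    have E: "fst (out u) \<in> edges G" "fst (inc u) \<in> edges G"
      using out(1)[OF that] inc(1)[OF that] edges by auto
    show "(u, g u) \<in> darts" "(u, f u) \<in> darts"
      using oedge_in_darts(1)[OF E(1)] oedge_in_darts(2)[OF E(2)] out(2) inc(2) that by (auto simp: g_def f_def)
    have "out u \<noteq> inc u"
      using out(2)[OF that] inc(2)[OF that] source_neq_target[OF E(1)] by auto
    then show "g u \<noteq> f u"
      using inj_onD[OF oriented_cycle_inj_fst[OF D] _ out(1)[OF that] inc(1)[OF that]] by (auto simp: g_def f_def)
    show "g u \<in> fst ` D" "f u \<in> fst ` D"
      using out(1)[OF that] inc(1)[OF that] by (auto simp: g_def f_def)
  qed
  have edge_at: "u \<in> V \<and> (x = g u \<or> x = f u)" if ux: "(u, x) \<in> darts" "x \<in> fst ` D" for u x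
  proof -
    obtain d where d: "d \<in> D" "x = fst d" using ux(2) by blast
    then have "u = oedge_source G d \<or> u = oedge_target G d"
      using ux(1) oedge_ends[of d] by (auto simp: darts_iff)
    then show ?thesis
      using at_source[OF d(1)] at_target[OF d(1)] d(2) by (auto simp: g_def f_def)
  qed
  \<comment> \<open>At a vertex off the cycle all corners lie on one side, given by the winding
    number at the vertex itself.\<close>
  define k where "k u x = (if u \<in> V then of_bool (\<not> left_corner u (g u) (f u) x)
    else L - Re (cycle_winding \<gamma> D u))" for u x
  have k_other: "k u x = L - Re (cycle_winding \<gamma> D (\<gamma> x (1 / 2)))" if ux: "(u, x) \<in> darts" "x \<notin> fst ` D" for u x
  proof (cases "u \<in> V")
    case True
    have E: "path (edge_from \<gamma> u x)" "pathstart (edge_from \<gamma> u x) = u"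
      using edge_from[OF ux(1)] by auto
    have dist: "r < dist u (pathfinish (edge_from \<gamma> u x))"
      using dist_pathfinish_edge_from[OF ux(1) r(2)] .
    have "0 < exit_time (edge_from \<gamma> u x) u r" "exit_time (edge_from \<gamma> u x) u r < 1"
      using exit_time(1)[OF E r(1)] exit_time_less_1[OF E r(1) dist] dist by auto
    then have "cycle_winding \<gamma> D (\<gamma> x (1 / 2)) = cycle_winding \<gamma> D (exit_point \<gamma> r u x)"
      using cycle_winding_edge(1)[OF D ux] by (simp add: exit_point_eq)
    also have "\<dots> = of_real (if angle u (g u) x < angle u (g u) (f u) then (\<epsilon> + 1) / 2 else (\<epsilon> - 1) / 2)"
      unfolding g_def f_def
      using cycle_winding_exit_point[OF D r \<epsilon> _ _ _ _ ux] out[OF True] inc[OF True] by simp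
    finally have eq: "cycle_winding \<gamma> D (\<gamma> x (1 / 2)) = \<dots>" .
    have "x \<noteq> g u" "x \<noteq> f u"
      using ux gf[OF True] by auto
    \<comment> \<open>The weak inequality places the corner before \<open>f u\<close>; for
      \<open>x\<close> other than \<open>f u\<close> it is strict, as distinct edges have distinct
      angles.\<close>
    then have "left_corner u (g u) (f u) x \<longleftrightarrow> angle u (g u) x < angle u (g u) (f u)"
      using angle_inj[OF gf(1)[OF True] ux(1) gf(2)[OF True]] by (auto simp: left_corner_def less_le)
    then show ?thesis
      using True by (simp add: k_def eq L_def field_simps)
  next
    case False
    then have "u \<notin> curve \<gamma> (fst ` D)"
      using curve_verts ux(1) by (auto simp: darts_def)
    then show ?thesis
      using cycle_winding_edge(2)[OF D ux] False by (simp add: k_def)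
  qed
  have k_rho: "k u (\<rho> u x) = k u x + (if u = head G x then chain D $ x else - (chain D $ x))"
    if ux: "(u, x) \<in> darts" for u x
  proof (cases "u \<in> V")
    case True
    note rho = left_corner_rho[OF gf(1,2)[OF True] ux gf(3)[OF True]]
    consider "x = g u" | "x = f u" "x \<noteq> g u" | "x \<noteq> g u" "x \<noteq> f u" by blast
    then show ?thesis
    proof cases
      case 1
      have "chain D $ x = orientation_sign (out u)"
        using oriented_cycle_chain_nth[OF D, of "fst (out u)" "snd (out u)"] out[OF True] 1 by (simp add: g_def)
      moreover have "u = head G x \<longleftrightarrow> \<not> snd (out u)"
        using out(2)[OF True] 1 no_loops[of x] ux by (auto simp: g_def oedge_source_def darts_iff split: if_splits)
      moreover have "\<not> left_corner u (g u) (f u) x"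
        using 1 by (simp add: left_corner_def)
      ultimately show ?thesis
        using True rho 1 by (simp add: k_def)
    next
      case 2
      have "chain D $ x = orientation_sign (inc u)"
        using oriented_cycle_chain_nth[OF D, of "fst (inc u)" "snd (inc u)"] inc[OF True] 2 by (simp add: f_def)
      moreover have "u = head G x \<longleftrightarrow> snd (inc u)"
        using inc(2)[OF True] 2 no_loops[of x] ux by (auto simp: f_def oedge_target_def darts_iff split: if_splits)
      moreover have "left_corner u (g u) (f u) x"
        using 2 by (simp add: left_corner_def)
      ultimately show ?thesis
        using True rho 2 by (simp add: k_def)
    next
      case 3
      then have "chain D $ x = 0"
        using edge_at[OF ux] oriented_cycle_chain_nth_eq_0_iff[OF D] by blast
      then show ?thesis
        using True rho 3 by (simp add: k_def)
    qed
  next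
    case False
    then have "chain D $ x = 0"
      using edge_at[OF ux] oriented_cycle_chain_nth_eq_0_iff[OF D] by blast
    then show ?thesis
      using False by (simp add: k_def)
  qed
  \<comment> \<open>The corner before an edge is on its clockwise side, seen from the vertex: this
    is the right of \<open>d\<close> at its source and the left at its target.\<close>
  have k_source: "k (oedge_source G d) (fst d) = 1" and k_target: "k (oedge_target G d) (fst d) = 0" if "d \<in> D" for d
    using at_source[OF that] at_target[OF that] gf(3)[OF at_target(1)[OF that]]
    by (auto simp: k_def left_corner_def g_def f_def)
  have k_other_end: "k u x = k (other_end G u x) (\<rho> (other_end G u x) x)" if ux: "(u, x) \<in> darts" for u x
  proof (cases "x \<in> fst ` D")
    case True
    then obtain d where d: "d \<in> D" "x = fst d" by blast
    then have dE: "fst d \<in> edges G" using edges by auto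
    have sign: "chain D $ x = orientation_sign d"
      using oriented_cycle_chain_nth[OF D, of "fst d" "snd d"] d by simp
    consider "u = oedge_source G d" | "u = oedge_target G d"
      using ux d(2) oedge_ends[of d] by (auto simp: darts_iff)
    then show ?thesis
    proof cases
      case 1
      then have "other_end G u x = oedge_target G d"
        using other_end_source[OF dE] d(2) by simp
      then show ?thesis
        using k_rho[OF oedge_in_darts(2)[OF dE]] k_source[OF d(1)] k_target[OF d(1)] 1 d(2) sign no_loops[OF dE]
        by (auto simp: oedge_target_def)
    next
      case 2
      then have "other_end G u x = oedge_source G d"
        using other_end_target[OF dE] d(2) by simp
      then show ?thesis
        using k_rho[OF oedge_in_darts(1)[OF dE]] k_source[OF d(1)] k_target[OF d(1)] 2 d(2) sign no_loops[OF dE]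
        by (auto simp: oedge_source_def)
    qed
  next
    case False
    then have "chain D $ x = 0"
      using oriented_cycle_chain_nth_eq_0_iff[OF D] by blast
    then show ?thesis
      using k_rho[OF other_end_in_darts[OF ux]] k_other[OF ux False] k_other[OF other_end_in_darts[OF ux] False]
      by simp
  qed
  have "k u x \<in> {0, 1}" if "(u, x) \<in> darts" for u x
  proof (cases "u \<in> V")
    case False
    then have "u \<notin> curve \<gamma> (fst ` D)"
      using curve_verts that by (auto simp: darts_def)
    then show ?thesis
      using \<epsilon>(2)[of u] \<epsilon>(1) False by (auto simp: k_def L_def)
  qed (simp add: k_def)
  moreover have "dual_potential (chain D) k"
    unfolding dual_potential_def using k_rho k_other_end by blast
  ultimately show ?thesis by blast
qed

end

context plane_ribbon_graph
begin

text \<open>Reversing a cycle swaps left and right. For values in \<open>{0, 1}\<close> the result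
  is again nonnegative.\<close>

lemma dual_potential_reverse:
  assumes "dual_potential z k"
  shows "dual_potential (- z) (\<lambda>u x. 1 - k u x)"
  using assms unfolding dual_potential_def by fastforce

theorem geometric_bernardi:
  assumes p: "p \<in> darts"
  shows "geometric_cycle_orientation_map G (bernardi G \<rho> p)"
proof (rule geometric_bernardi_if_dual_potentials[OF p])
  fix C assume "is_cycle G C"
  then obtain D where D: "oriented_cycle G D" "fst ` D = C"
    by (auto simp: is_cycle_def)
  obtain r where r: "0 < r" "\<And>u w. u \<in> verts G \<Longrightarrow> w \<in> verts G \<Longrightarrow> u \<noteq> w \<Longrightarrow> r < dist u w"
    "\<And>u x. (u, x) \<in> darts \<Longrightarrow> ccw_next G \<gamma> r u x (\<rho> u x)"
    using small_radius by metis
  interpret small_disc G \<gamma> \<rho> r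
    using r by unfold_locales auto
  obtain k where k: "dual_potential (chain D) k" "\<forall>(u, x)\<in>darts. k u x \<in> {0, 1}"
    using ex_dual_potential[OF D(1)] by blast
  have "k (fst p) (snd p) = 0 \<or> k (fst p) (snd p) = 1"
    using k(2) p by force
  then show "\<exists>D k. oriented_cycle G D \<and> fst ` D = C \<and> dual_potential (chain D) k \<and>
      (\<forall>(u, x)\<in>darts. 0 \<le> k u x) \<and> k (fst p) (snd p) = 0"
  proof
    assume "k (fst p) (snd p) = 0"
    then show ?thesis
      using D k by (intro exI[of _ D] exI[of _ k]) auto
  next
    assume "k (fst p) (snd p) = 1"
    moreover have "fst ` apsnd Not ` D = C"
      using D(2) by (auto simp: image_image)
    moreover have "dual_potential (chain (apsnd Not ` D)) (\<lambda>u x. 1 - k u x)"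
      unfolding chain_reverse using dual_potential_reverse[OF k(1)] .
    ultimately show ?thesis
      using oriented_cycle_reverse[OF D(1)] k(2)
      by (intro exI[of _ "apsnd Not ` D"] exI[of _ "\<lambda>u x. 1 - k u x"]) fastforce
  qed
qed

end

theorem theorem5p3:
  fixes G :: "(complex, 'e::finite) multigraph"
    and \<gamma> :: "'e \<Rightarrow> real \<Rightarrow> complex"
    and \<rho> :: "complex \<Rightarrow> 'e \<Rightarrow> 'e"
    and v :: complex and e :: 'e
  assumes "plane_graph G \<gamma>"
    and "induced_ribbon_structure G \<gamma> \<rho>"
    and "v \<in> verts G" and "e \<in> incident G v"
  shows "geometric_cycle_orientation_map G (bernardi G \<rho> (v, e))"
proof -
  interpret plane_ribbon_graph G \<gamma> \<rho>
    using assms(1,2) by (simp add: plane_ribbon_graph_def plane_ribbon_graph_axioms_def)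
  show ?thesis
    using assms(3,4) by (intro geometric_bernardi) (simp add: darts_def)
qed

end
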